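(* For every $r\geq 2$ there exists a real number $M_r$ such that, if $T$ is an Erdős–Sós tree on $t\geq M_r$ vertices and $\mathcal{T}$ is the $(r-2)$-expansion of $T$, then $\mathrm{Forb}(\mathcal{T})$ is $\mathfrak{B}(\mathcal{K}_{t+r-3}^{(r)})$-weakly weight stable.
   Context: $r$-graph = $r$-uniform hypergraph; $\mathrm{Forb}(\mathcal{T})$ is the family of $r$-graphs with no (not necessarily induced) copy of $\mathcal{T}$; $\mathcal{K}^{(r)}_p$ is the complete $r$-graph on $p$ vertices. A tree $T$ on $k$ vertices is an Erdős–Sós tree if every simple graph with average degree greater than $k-2$ contains $T$. The $(r-2)$-expansion of a graph $G$ is the $r$-graph obtained by adding $r-2$ new vertices and enlarging every edge of $G$ by these $r-2$ vertices. Blowups: the link of $v$ is $L_{\mathcal{F}}(v)=\{I:|I|=r-1, I\cup\{v\}\in\mathcal{F}\}$; $\mathcal{G}$ is obtained from $\mathcal{F}$ by cloning $v$ to $W$ if $\mathcal{F}\subseteq\mathcal{G}$, $V(\mathcal{G})\setminus V(\mathcal{F})=W\setminus\{v\}$, $L_{\mathcal{G}}(w)=L_{\mathcal{F}}(v)$ for $w\in W$; $\mathfrak{B}(\mathcal{F})$ is the set of $r$-graphs isomorphic to those obtained from $\mathcal{F}$ by repeated cloning and deleting of vertices. Weighted graphs: $\mathcal{M}(\mathcal{F})$ is the set of probability distributions $\mu$ on $V(\mathcal{F})$. The density is $\lambda(\mathcal{F},\mu)=\sum_{F\in\mathcal{F}}\prod_{v\in F}\mu(v)$; the Lagrangian is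 $\lambda(\mathcal{F})=\max_{\mu}\lambda(\mathcal{F},\mu)$, and for a family $\lambda(\mathfrak{F})=\sup_{\mathcal{F}\in\mathfrak{F}}\lambda(\mathcal{F})$. If $\mathcal{F}'$ is obtained from $\mathcal{F}$ by cloning $u$ to $W$, $(\mathcal{F}',\mu')$ is a one-vertex blowup of $(\mathcal{F},\mu)$ if $\mu'=\mu$ off $W$ and $\mu(u)=\sum_{w\in W}\mu'(w)$; $\mathfrak{B}(\mathcal{F},\mu)$ is the set of weighted graphs isomorphic (via weight-preserving isomorphisms) to those obtained by repeated one-vertex blowups. For $\mathcal{F}_1,\mathcal{F}_2$ on a common vertex set with common $\mu$, $d'(\mathcal{F}_1,\mathcal{F}_2,\mu)=\sum_{F\in\mathcal{F}_1\triangle\mathcal{F}_2}\prod_{v\in F}\mu(v)$; $d((\mathcal{F}_1,\mu_1),(\mathcal{F}_2,\mu_2))=\inf d'(\mathcal{F}_1',\mathcal{F}_2',\mu)$ over all $\mathcal{F}'_1,\mathcal{F}'_2$ on a common vertex set and $\mu$ with $(\mathcal{F}'_i,\mu)\in\mathfrak{B}(\mathcal{F}_i,\mu_i)$; and $d_{\mathfrak{H}}(\mathcal{F},\mu)=\inf_{\mathcal{F}'\in\mathfrak{H},\mu'\in\mathcal{M}(\mathcal{F}')} d((\mathcal{F},\mu),(\mathcal{F}',\mu'))$. A family $\mathfrak{F}$ is $\mathfrak{H}$-weakly weight stable if for every $\varepsilon>0$ there is $\delta>0$ such that for all $\mathcal{F}\in\mathfrak{F}$ and $\mu\in\mathcal{M}(\mathcal{F})$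 with $\lambda(\mathcal{F},\mu)\ge\lambda(\mathfrak{H})-\delta$ we have $d_{\mathfrak{H}}(\mathcal{F},\mu)\le\varepsilon$. *)

theory Defs
  imports Complex_Main
begin

text \<open>
  Hypergraphs carry an explicit vertex set and isolated vertices are allowed. Vertex sets are
  finite and nonempty: the empty hypergraph has no probability distribution on its vertex set,
  hence no Lagrangian. Families of hypergraphs are taken up to isomorphism, so the vertex type
  only has to be infinite; in the main statement it is \<^typ>\<open>nat\<close>.
\<close>

datatype 'a hypergraph = Hypergraph (verts: "'a set") (edges: "'a set set")

definition rgraph :: "nat \<Rightarrow> 'a hypergraph \<Rightarrow> bool" where
  "rgraph r F \<longleftrightarrow> finite (verts F) \<and> verts F \<noteq> {} \<and>
     (\<forall>e \<in> edges F. e \<subseteq> verts F \<and> card e = r)"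

definition hg_iso :: "('a \<Rightarrow> 'b) \<Rightarrow> 'a hypergraph \<Rightarrow> 'b hypergraph \<Rightarrow> bool" where
  "hg_iso f F G \<longleftrightarrow> bij_betw f (verts F) (verts G) \<and> edges G = (\<lambda>e. f ` e) ` edges F"

definition contains_copy :: "'a hypergraph \<Rightarrow> 'b hypergraph \<Rightarrow> bool" where
  "contains_copy F T \<longleftrightarrow> (\<exists>f. inj_on f (verts T) \<and> f ` verts T \<subseteq> verts F \<and>
     (\<forall>e \<in> edges T. f ` e \<in> edges F))"

definition Forb :: "nat \<Rightarrow> 'b hypergraph \<Rightarrow> 'a hypergraph set" where
  "Forb r T = {F. rgraph r F \<and> \<not> contains_copy F T}"

definition complete_rgraph :: "nat \<Rightarrow> nat \<Rightarrow> nat hypergraph" where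
  "complete_rgraph r p = Hypergraph {..<p} {e. e \<subseteq> {..<p} \<and> card e = r}"


subsection \<open>Trees and expansions\<close>

text \<open>Simple graphs are \<open>2\<close>-graphs.\<close>

definition adjacent :: "'a hypergraph \<Rightarrow> 'a \<Rightarrow> 'a \<Rightarrow> bool" where
  "adjacent G u v \<longleftrightarrow> {u, v} \<in> edges G"

definition graph_connected :: "'a hypergraph \<Rightarrow> bool" where
  "graph_connected G \<longleftrightarrow> (\<forall>u \<in> verts G. \<forall>v \<in> verts G. (adjacent G)\<^sup>*\<^sup>* u v)"

definition graph_cycle :: "'a hypergraph \<Rightarrow> 'a list \<Rightarrow> bool" where
  "graph_cycle G c \<longleftrightarrow> length c \<ge> 3 \<and> distinct c \<and>
     successively (adjacent G) c \<and> adjacent G (last c) (hd c)"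

definition is_tree :: "'a hypergraph \<Rightarrow> bool" where
  "is_tree T \<longleftrightarrow> rgraph 2 T \<and> graph_connected T \<and> (\<nexists>c. graph_cycle T c)"

definition vertex_degree :: "'a hypergraph \<Rightarrow> 'a \<Rightarrow> nat" where
  "vertex_degree G v = card {e \<in> edges G. v \<in> e}"

definition average_degree :: "'a hypergraph \<Rightarrow> real" where
  "average_degree G = (\<Sum>v \<in> verts G. real (vertex_degree G v)) / real (card (verts G))"

definition erdos_sos_tree :: "'a hypergraph \<Rightarrow> bool" where
  "erdos_sos_tree T \<longleftrightarrow> is_tree T \<and>
     (\<forall>G :: nat hypergraph. rgraph 2 G \<and> average_degree G > real (card (verts T)) - 2
        \<longrightarrow> contains_copy G T)"

text \<open>The \<open>s\<close>-expansion; the right summand of the vertex type holds the \<open>s\<close> new vertices.\<close>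

definition expansion :: "nat \<Rightarrow> 'a hypergraph \<Rightarrow> ('a + nat) hypergraph" where
  "expansion s G = Hypergraph (Inl ` verts G \<union> Inr ` {..<s})
     {Inl ` e \<union> Inr ` {..<s} | e. e \<in> edges G}"


subsection \<open>Blowups\<close>

text \<open>
  In an \<open>r\<close>-graph, the condition \<open>v \<notin> I\<close> says precisely that \<open>card I = r - 1\<close>.
\<close>

definition link :: "'a hypergraph \<Rightarrow> 'a \<Rightarrow> 'a set set" where
  "link F v = {I. v \<notin> I \<and> insert v I \<in> edges F}"

text \<open>
  The last condition makes explicit that cloning \<open>v\<close> to \<open>W\<close> changes the hypergraph at \<open>W\<close> only:
  the inclusion of \<open>F\<close> in \<open>G\<close> and the condition on the links do not by themselves exclude new
  edges among the old vertices other than \<open>v\<close>.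
\<close>

definition clone :: "'a hypergraph \<Rightarrow> 'a \<Rightarrow> 'a set \<Rightarrow> 'a hypergraph \<Rightarrow> bool" where
  "clone F v W G \<longleftrightarrow> v \<in> verts F \<and> v \<in> W \<and> finite W \<and>
     verts F \<subseteq> verts G \<and> edges F \<subseteq> edges G \<and>
     verts G - verts F = W - {v} \<and>
     (\<forall>w \<in> W. link G w = link F v) \<and>
     (\<forall>e \<in> edges G - edges F. e \<inter> W \<noteq> {})"

definition delete_vertex :: "'a hypergraph \<Rightarrow> 'a \<Rightarrow> 'a hypergraph" where
  "delete_vertex F v = Hypergraph (verts F - {v}) {e \<in> edges F. v \<notin> e}"

inductive clone_delete_step :: "'a hypergraph \<Rightarrow> 'a hypergraph \<Rightarrow> bool" where
  cloning: "clone F v W G \<Longrightarrow> clone_delete_step F G"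
| deleting: "v \<in> verts F \<Longrightarrow> verts F \<noteq> {v} \<Longrightarrow> clone_delete_step F (delete_vertex F v)"

definition blowups :: "'a hypergraph \<Rightarrow> 'a hypergraph set" where
  "blowups F = {H. \<exists>G f. clone_delete_step\<^sup>*\<^sup>* F G \<and> hg_iso f G H}"


subsection \<open>Weighted hypergraphs\<close>

text \<open>
  A distribution on \<^term>\<open>verts F\<close> is a function whose values outside \<^term>\<open>verts F\<close> are
  irrelevant: no notion below looks at them.
\<close>

definition distributions :: "'a hypergraph \<Rightarrow> ('a \<Rightarrow> real) set" where
  "distributions F = {\<mu>. (\<forall>v \<in> verts F. \<mu> v \<ge> 0) \<and> (\<Sum>v \<in> verts F. \<mu> v) = 1}"

definition hg_density :: "'a hypergraph \<Rightarrow> ('a \<Rightarrow> real) \<Rightarrow> real" where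
  "hg_density F \<mu> = (\<Sum>e \<in> edges F. \<Prod>v \<in> e. \<mu> v)"

text \<open>The supremum is attained, since the distributions on a finite set form a compact simplex.\<close>

definition lagrangian :: "'a hypergraph \<Rightarrow> real" where
  "lagrangian F = (SUP \<mu> \<in> distributions F. hg_density F \<mu>)"

definition family_lagrangian :: "'a hypergraph set \<Rightarrow> real" where
  "family_lagrangian \<FF> = (SUP F \<in> \<FF>. lagrangian F)"

type_synonym 'a weighted = "'a hypergraph \<times> ('a \<Rightarrow> real)"

definition one_vertex_blowup :: "'a weighted \<Rightarrow> 'a weighted \<Rightarrow> bool" where
  "one_vertex_blowup = (\<lambda>(F, \<mu>) (F', \<mu>'). \<exists>u W. clone F u W F' \<and> \<mu>' \<in> distributions F' \<and>
     (\<forall>v \<in> verts F' - W. \<mu>' v = \<mu> v) \<and> \<mu> u = (\<Sum>w \<in> W. \<mu>' w))"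

definition weighted_iso :: "'a weighted \<Rightarrow> 'a weighted \<Rightarrow> bool" where
  "weighted_iso = (\<lambda>(F, \<mu>) (F', \<mu>'). \<exists>f. hg_iso f F F' \<and> (\<forall>v \<in> verts F. \<mu>' (f v) = \<mu> v))"

definition weighted_blowups :: "'a weighted \<Rightarrow> 'a weighted set" where
  "weighted_blowups X = {Z. \<exists>Y. one_vertex_blowup\<^sup>*\<^sup>* X Y \<and> weighted_iso Y Z}"

definition dist_common :: "'a hypergraph \<Rightarrow> 'a hypergraph \<Rightarrow> ('a \<Rightarrow> real) \<Rightarrow> real" where
  "dist_common F1 F2 \<mu> = (\<Sum>e \<in> sym_diff (edges F1) (edges F2). \<Prod>v \<in> e. \<mu> v)"

definition weighted_dist :: "'a weighted \<Rightarrow> 'a weighted \<Rightarrow> real" where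
  "weighted_dist X1 X2 = Inf {dist_common F1 F2 \<mu> | F1 F2 \<mu>.
     verts F1 = verts F2 \<and> (F1, \<mu>) \<in> weighted_blowups X1 \<and> (F2, \<mu>) \<in> weighted_blowups X2}"

definition dist_to_family :: "'a hypergraph set \<Rightarrow> 'a weighted \<Rightarrow> real" where
  "dist_to_family \<HH> X = Inf {weighted_dist X (F', \<mu>') | F' \<mu>'. F' \<in> \<HH> \<and> \<mu>' \<in> distributions F'}"

definition weakly_weight_stable :: "'a hypergraph set \<Rightarrow> 'a hypergraph set \<Rightarrow> bool" where
  "weakly_weight_stable \<HH> \<FF> \<longleftrightarrow> (\<forall>\<epsilon>>0. \<exists>\<delta>>0. \<forall>F \<in> \<FF>. \<forall>\<mu> \<in> distributions F.
     hg_density F \<mu> \<ge> family_lagrangian \<HH> - \<delta> \<longrightarrow> dist_to_family \<HH> (F, \<mu>) \<le> \<epsilon>)"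

end

theory Submission
  imports Defs "HOL-Analysis.Function_Topology"
begin

text \<open>
  Write \<open>d = t - 2\<close> and \<open>m = t + r - 3 = d + r - 1\<close>. In a \<open>\<T>\<close>-free \<open>r\<close>-graph the link graph of every
  \<open>(r - 2)\<close>-set has at most \<open>d |A| / 2\<close> edges on every vertex set \<open>A\<close>. Following Sidorenko, one
  bounds the density of a weighting with total weight \<open>s\<close> and all weights at most \<open>a \<le> s / m\<close> by
  \<open>(d / r!) a s (s - a) \<cdots> (s - (r - 2) a)\<close>: at a maximizer the link of a heaviest vertex carries at
  least an average share of the density, and induction on \<open>r\<close> applies to this link. For \<open>d\<close> large
  this bound increases in \<open>a\<close>, and at \<open>a = s / m\<close> it is the density of \<open>K\<^sub>m\<close>. Heavier weights are
  handled by the Lagrangian bound for the link of the heaviest vertex.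

  If the density is within \<open>\<delta>\<close> of the optimum, moving weight \<open>\<surd>\<delta>\<close> from the heaviest vertex to any
  other cannot gain more than \<open>\<delta>\<close>. Hence the heaviest weight is close to \<open>1 / m\<close> and the link of that
  vertex is again nearly optimal, so by induction there are \<open>m\<close> vertices of weight close to
  \<open>1 / m\<close>. The blowup of \<open>K\<^sub>m\<close> in which these vertices lie in distinct parts, and all others join one
  of the parts, is then close to the given hypergraph on the same weighted vertex set.
\<close>

subsection \<open>Weighted uniform hypergraphs\<close>

text \<open>A layer-cake argument: a nonnegative weighting is a combination of indicators of its
  superlevel sets, and the minimum over an edge is additive along this chain. On one layer the claim
  is the edge count assumed for vertex sets. The induction peels off the lowest layer.\<close>

lemma sum_Min_le:
  fixes x :: "'a \<Rightarrow> real"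
  assumes "finite V" and "\<And>e. e \<in> E \<Longrightarrow> e \<subseteq> V \<and> e \<noteq> {}"
    and "\<And>A. A \<subseteq> V \<Longrightarrow> real (card {e \<in> E. e \<subseteq> A}) \<le> c * real (card A)"
    and "\<And>v. v \<in> V \<Longrightarrow> 0 \<le> x v"
  shows "(\<Sum>e\<in>E. Min (x ` e)) \<le> c * (\<Sum>v\<in>V. x v)"
  using assms
proof (induction V arbitrary: E x rule: finite_psubset_induct)
  case (psubset V)
  show ?case
  proof (cases "V = {}")
    case True
    then have "E = {}" using psubset.prems(1) by auto
    then show ?thesis using True by simp
  next
    case False
    have finE: "finite E"
      using psubset.prems(1) psubset.hyps by (meson PowI finite_Pow_iff finite_subset subsetI)
    obtain w where w: "w \<in> V" "x w = Min (x ` V)"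
      using Min_in[of "x ` V"] False psubset.hyps by (metis (no_types) finite_imageI imageE image_is_empty)
    have w_le: "x w \<le> x v" if "v \<in> V" for v
      using w that psubset.hyps by simp
    \<comment> \<open>Subtracting the lowest weight everywhere gives \<open>w\<close> weight 0, so
      the induction hypothesis applies to \<open>V - {w}\<close>. The removed layer is constant and
      costs at most \<open>c * card V * x w\<close>.\<close>
    define y where "y = (\<lambda>v. x v - x w)"
    define E' where "E' = {e \<in> E. e \<subseteq> V - {w}}"
    have "(\<Sum>e\<in>E'. Min (y ` e)) \<le> c * (\<Sum>v\<in>V - {w}. y v)"
    proof (rule psubset.IH)
      show "V - {w} \<subset> V" using w by auto
      show "e \<subseteq> V - {w} \<and> e \<noteq> {}" if "e \<in> E'" for e
        using that psubset.prems(1) unfolding E'_def by auto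
      show "real (card {e \<in> E'. e \<subseteq> A}) \<le> c * real (card A)" if "A \<subseteq> V - {w}" for A
      proof -
        have "{e \<in> E'. e \<subseteq> A} = {e \<in> E. e \<subseteq> A}" using that unfolding E'_def by auto
        then show ?thesis using psubset.prems(2)[of A] that by auto
      qed
      show "0 \<le> y v" if "v \<in> V - {w}" for v using w_le that by (auto simp: y_def)
    qed
    moreover have "Min (x ` e) = Min (y ` e) + x w" if "e \<in> E" for e
    proof -
      have "finite e" "e \<noteq> {}" using that psubset.prems(1) psubset.hyps finite_subset by blast+
      then have "Min ((\<lambda>v. y v + x w) ` e) = Min (y ` e) + x w"
        by (rule Min_add_commute)
      then show ?thesis by (simp add: y_def)
    qed
    \<comment> \<open>Edges through \<open>w\<close> have minimum 0 after the subtraction, so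
      nothing is lost by deleting \<open>w\<close>.\<close>
    moreover have "(\<Sum>e\<in>E. Min (y ` e)) = (\<Sum>e\<in>E'. Min (y ` e))"
    proof (rule sum.mono_neutral_right[OF finE])
      show "E' \<subseteq> E" unfolding E'_def by auto
      show "\<forall>e\<in>E - E'. Min (y ` e) = 0"
      proof
        fix e assume e: "e \<in> E - E'"
        then have we: "w \<in> e" "e \<subseteq> V" using psubset.prems(1) unfolding E'_def by auto
        then have "finite (y ` e)" using psubset.hyps finite_subset by blast
        moreover have "0 \<in> y ` e" using we by (auto simp: y_def)
        moreover have "0 \<le> b" if "b \<in> y ` e" for b using that w_le we by (auto simp: y_def)
        ultimately show "Min (y ` e) = 0" by (intro Min_eqI)
      qed
    qed
    moreover have "card E * x w \<le> c * card V * x w"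
    proof -
      have "{e \<in> E. e \<subseteq> V} = E" using psubset.prems(1) by auto
      then show ?thesis using psubset.prems(2)[of V] psubset.prems(3)[OF w(1)]
        by (simp add: mult_right_mono)
    qed
    moreover have "(\<Sum>v\<in>V. x v) = (\<Sum>v\<in>V - {w}. y v) + card V * x w"
    proof -
      have "(\<Sum>v\<in>V. x v) = (\<Sum>v\<in>V. y v) + card V * x w"
        by (simp add: y_def sum_subtractf)
      also have "(\<Sum>v\<in>V. y v) = (\<Sum>v\<in>V - {w}. y v)"
        using w psubset.hyps by (simp add: sum.remove y_def)
      finally show ?thesis .
    qed
    ultimately show ?thesis by (simp add: sum.distrib algebra_simps)
  qed
qed

text \<open>In contrast to \<open>rgraph\<close>, the vertex set may be empty. This makes the notion
  stable under passing to the link of a vertex, on which all inductions below run.\<close>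

definition uniform :: "nat \<Rightarrow> 'a set \<Rightarrow> 'a set set \<Rightarrow> bool" where
  "uniform r V E \<longleftrightarrow> finite V \<and> (\<forall>e\<in>E. e \<subseteq> V \<and> card e = r)"

definition edge_density :: "'a set set \<Rightarrow> ('a \<Rightarrow> real) \<Rightarrow> real" where
  "edge_density E x = (\<Sum>e\<in>E. \<Prod>v\<in>e. x v)"

definition link_edges :: "'a set set \<Rightarrow> 'a \<Rightarrow> 'a set set" where
  "link_edges E w = {I. w \<notin> I \<and> insert w I \<in> E}"

lemma uniform_finite: "uniform r V E \<Longrightarrow> finite E"
  unfolding uniform_def by (meson PowI finite_Pow_iff finite_subset subsetI)

lemma uniform_finite_edge: "uniform r V E \<Longrightarrow> e \<in> E \<Longrightarrow> finite e"
  unfolding uniform_def using finite_subset by blast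

lemma uniform_link: "uniform (Suc r) V E \<Longrightarrow> uniform r (V - {w}) (link_edges E w)"
proof -
  assume E: "uniform (Suc r) V E"
  have "card I = r" if "w \<notin> I" "insert w I \<in> E" for I
  proof -
    have "finite (insert w I)" "card (insert w I) = Suc r"
      using E that uniform_finite_edge uniform_def by metis+
    then show ?thesis using that by simp
  qed
  then show ?thesis using E unfolding uniform_def link_edges_def by auto
qed

lemma edge_density_nonneg:
  assumes "uniform r V E" and "\<And>v. v \<in> V \<Longrightarrow> 0 \<le> x v"
  shows "0 \<le> edge_density E x"
  unfolding edge_density_def using assms by (intro sum_nonneg prod_nonneg) (auto simp: uniform_def)

lemma edge_density_mono_edges:
  assumes "uniform r V E" and "\<And>v. v \<in> V \<Longrightarrow> 0 \<le> x v" and "E' \<subseteq> E"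
  shows "edge_density E' x \<le> edge_density E x"
  unfolding edge_density_def using assms uniform_finite[OF assms(1)]
  by (intro sum_mono2 prod_nonneg) (auto simp: uniform_def)

lemma edge_density_cong:
  assumes "uniform r V E" and "\<And>v. v \<in> V \<Longrightarrow> x v = y v"
  shows "edge_density E x = edge_density E y"
  unfolding edge_density_def using assms by (intro sum.cong prod.cong) (auto simp: uniform_def)

lemma edge_density_scale:
  assumes "uniform r V E"
  shows "edge_density E (\<lambda>v. c * x v) = c ^ r * edge_density E x"
  unfolding edge_density_def sum_distrib_left using assms
  by (intro sum.cong) (auto simp: uniform_def prod.distrib)

section \<open>Links as partial derivatives of the density\<close>

lemma edge_density_link:
  assumes "uniform r V E"
  shows "x w * edge_density (link_edges E w) x = (\<Sum>e | e \<in> E \<and> w \<in> e. \<Prod>v\<in>e. x v)"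
proof -
  have "(\<Sum>e | e \<in> E \<and> w \<in> e. \<Prod>v\<in>e. x v) = (\<Sum>I\<in>link_edges E w. \<Prod>v\<in>insert w I. x v)"
  proof (rule sum.reindex_bij_betw[symmetric])
    show "bij_betw (insert w) (link_edges E w) {e. e \<in> E \<and> w \<in> e}"
      by (rule bij_betw_byWitness[where f' = "\<lambda>e. e - {w}"])
        (auto simp: link_edges_def insert_absorb)
  qed
  also have "\<dots> = (\<Sum>I\<in>link_edges E w. x w * (\<Prod>v\<in>I. x v))"
  proof (rule sum.cong)
    fix I assume "I \<in> link_edges E w"
    then have "w \<notin> I" "finite I"
      using uniform_finite_edge[OF assms, of "insert w I"] by (auto simp: link_edges_def)
    then show "(\<Prod>v\<in>insert w I. x v) = x w * (\<Prod>v\<in>I. x v)" by simp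
  qed simp
  finally show ?thesis by (simp add: edge_density_def sum_distrib_left)
qed

lemma edge_density_split:
  assumes "uniform r V E"
  shows "edge_density E x = x w * edge_density (link_edges E w) x + edge_density {e \<in> E. w \<notin> e} x"
proof -
  have "E = {e \<in> E. w \<in> e} \<union> {e \<in> E. w \<notin> e}" by auto
  then have "edge_density E x = edge_density {e \<in> E. w \<in> e} x + edge_density {e \<in> E. w \<notin> e} x"
    unfolding edge_density_def
    by (subst sum.union_disjoint[symmetric]) (use uniform_finite[OF assms] in auto)
  then show ?thesis using edge_density_link[OF assms, of x w] by (simp add: edge_density_def)
qed

lemma edge_density_upd_notin: "\<forall>e\<in>E. w \<notin> e \<Longrightarrow> edge_density E (x(w := c)) = edge_density E x"
  unfolding edge_density_def by (intro sum.cong prod.cong) auto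

text \<open>An edge contains a vertex at most once, so the density is affine in each single weight,
  with the link density as slope.\<close>

lemma edge_density_upd:
  assumes "uniform r V E"
  shows "edge_density E (x(w := x w + h)) = edge_density E x + h * edge_density (link_edges E w) x"
  using edge_density_split[OF assms, of x w] edge_density_split[OF assms, of "x(w := x w + h)" w]
  by (simp add: edge_density_upd_notin link_edges_def algebra_simps)

text \<open>The exact effect of moving weight \<open>h\<close> from \<open>w\<close> to
  \<open>u\<close>. The quadratic term comes from the edges containing both vertices.\<close>

lemma edge_density_shift:
  assumes "uniform (Suc r) V E" and "u \<noteq> w"
  shows "edge_density E (x(u := x u + h, w := x w - h)) =
    edge_density E x + h * (edge_density (link_edges E u) x - edge_density (link_edges E w) x)
      - h\<^sup>2 * edge_density (link_edges (link_edges E w) u) x"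
proof -
  define y where "y = x(u := x u + h)"
  have "edge_density E (y(w := y w + (- h))) = edge_density E y - h * edge_density (link_edges E w) y"
    by (subst edge_density_upd[OF assms(1)]) simp
  moreover have "edge_density E y = edge_density E x + h * edge_density (link_edges E u) x"
    unfolding y_def by (rule edge_density_upd[OF assms(1)])
  moreover have "edge_density (link_edges E w) y =
      edge_density (link_edges E w) x + h * edge_density (link_edges (link_edges E w) u) x"
    unfolding y_def by (rule edge_density_upd[OF uniform_link[OF assms(1)]])
  ultimately show ?thesis using assms(2)
    by (simp add: y_def algebra_simps power2_eq_square)
qed

text \<open>Euler's identity for a homogeneous polynomial of degree \<open>r\<close>: each edge is
  counted once for each of its vertices.\<close>

lemma sum_edge_density_link:
  assumes "uniform r V E"
  shows "(\<Sum>v\<in>V. x v * edge_density (link_edges E v) x) = real r * edge_density E x"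
proof -
  have fin: "finite E" "finite V" using assms uniform_finite by (auto simp: uniform_def)
  have "(\<Sum>v\<in>V. x v * edge_density (link_edges E v) x) =
      (\<Sum>v\<in>V. \<Sum>e | e \<in> E \<and> v \<in> e. \<Prod>v\<in>e. x v)"
    using edge_density_link[OF assms] by simp
  also have "\<dots> = (\<Sum>e\<in>E. \<Sum>v | v \<in> V \<and> v \<in> e. \<Prod>v\<in>e. x v)"
    by (rule sum.swap_restrict) (use fin in auto)
  also have "\<dots> = (\<Sum>e\<in>E. real r * (\<Prod>v\<in>e. x v))"
  proof (rule sum.cong)
    fix e assume "e \<in> E"
    then have "{v. v \<in> V \<and> v \<in> e} = e" "card e = r" using assms by (auto simp: uniform_def)
    then show "(\<Sum>v | v \<in> V \<and> v \<in> e. \<Prod>v\<in>e. x v) = real r * (\<Prod>v\<in>e. x v)" by simp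
  qed simp
  finally show ?thesis by (simp add: edge_density_def sum_distrib_left)
qed

lemma edge_density_le_power:
  assumes "uniform r V E" and "\<And>v. v \<in> V \<Longrightarrow> 0 \<le> x v"
  shows "edge_density E x \<le> (\<Sum>v\<in>V. x v) ^ r"
  using assms
proof (induction r arbitrary: V E)
  case 0
  have "E \<subseteq> {{}}"
    using 0(1) uniform_finite_edge[OF 0(1)] by (auto simp: uniform_def)
  then have "E = {} \<or> E = {{}}" by auto
  then show ?case by (auto simp: edge_density_def)
next
  case (Suc r)
  let ?s = "\<Sum>v\<in>V. x v"
  have finV: "finite V" using Suc.prems by (auto simp: uniform_def)
  \<comment> \<open>The crude factor \<open>1 + real r\<close> creates the left side of Euler's
    identity; the links are then bounded by induction.\<close>
  have "edge_density E x \<le> (1 + real r) * edge_density E x"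
    using edge_density_nonneg[OF Suc.prems] by (simp add: algebra_simps)
  also have "\<dots> = (\<Sum>v\<in>V. x v * edge_density (link_edges E v) x)"
    using sum_edge_density_link[OF Suc.prems(1), of x] by simp
  also have "\<dots> \<le> (\<Sum>v\<in>V. x v * ?s ^ r)"
  proof (rule sum_mono)
    fix v assume v: "v \<in> V"
    have "edge_density (link_edges E v) x \<le> (\<Sum>v\<in>V - {v}. x v) ^ r"
      using Suc.IH[OF uniform_link[OF Suc.prems(1)]] Suc.prems(2) by simp
    also have "\<dots> \<le> ?s ^ r"
      by (intro power_mono sum_mono2 sum_nonneg) (use finV Suc.prems(2) in auto)
    finally show "x v * edge_density (link_edges E v) x \<le> x v * ?s ^ r"
      using Suc.prems(2)[OF v] by (rule mult_left_mono)
  qed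
  also have "\<dots> = ?s ^ Suc r" by (simp add: sum_distrib_right)
  finally show ?case .
qed

section \<open>Compactness of the capped simplex\<close>

lemma capped_simplex_maximizer:
  fixes x :: "'a \<Rightarrow> real"
  assumes "uniform r V E"
    and "\<And>v. v \<in> V \<Longrightarrow> 0 \<le> x v" and "\<And>v. v \<in> V \<Longrightarrow> x v \<le> a" and "(\<Sum>v\<in>V. x v) = s"
  obtains y where "\<And>v. v \<in> V \<Longrightarrow> 0 \<le> y v" and "\<And>v. v \<in> V \<Longrightarrow> y v \<le> a"
    and "(\<Sum>v\<in>V. y v) = s" and "edge_density E x \<le> edge_density E y"
    and "\<And>z. \<lbrakk>\<And>v. v \<in> V \<Longrightarrow> 0 \<le> z v; \<And>v. v \<in> V \<Longrightarrow> z v \<le> a; (\<Sum>v\<in>V. z v) = s\<rbrakk>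
      \<Longrightarrow> edge_density E z \<le> edge_density E y"
proof -
  \<comment> \<open>Weights outside \<open>V\<close> are pinned to 0. The box is then a product of
    compact sets, hence compact in the product topology on all functions, even over an infinite
    vertex type.\<close>
  define B where "B = PiE UNIV (\<lambda>v. if v \<in> V then {0..a} else {0})"
  define K where "K = B \<inter> {y. (\<Sum>v\<in>V. y v) = s}"
  define ext where "ext = (\<lambda>z v. if v \<in> V then z v else (0::real))"
  have ext: "ext z \<in> K"
    if "\<And>v. v \<in> V \<Longrightarrow> 0 \<le> z v" "\<And>v. v \<in> V \<Longrightarrow> z v \<le> a" "(\<Sum>v\<in>V. z v) = s" for z
    using that by (auto simp: K_def B_def ext_def)
  have ext_dens: "edge_density E (ext z) = edge_density E z" for z
    by (rule edge_density_cong[OF assms(1)]) (simp add: ext_def)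
  have "compact B"
  proof -
    have "compactin (product_topology (\<lambda>_. euclidean) UNIV) B"
      unfolding B_def by (subst compactin_PiE) auto
    then show ?thesis by (simp add: euclidean_product_topology)
  qed
  moreover have "closed {y :: 'a \<Rightarrow> real. (\<Sum>v\<in>V. y v) = s}"
    by (intro closed_Collect_eq continuous_intros continuous_on_product_then_coordinatewise)
  ultimately have "compact K" unfolding K_def by (rule compact_Int_closed)
  moreover have "K \<noteq> {}" using ext[of x] assms by auto
  moreover have "continuous_on K (edge_density E)"
    unfolding edge_density_def
    by (intro continuous_intros continuous_on_subset[OF continuous_on_product_coordinates]) auto
  ultimately obtain y where y: "y \<in> K" "\<And>z. z \<in> K \<Longrightarrow> edge_density E z \<le> edge_density E y"
    using continuous_attains_sup[of K "edge_density E"] by auto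
  show thesis
  proof (rule that[of y])
    show "0 \<le> y v" "y v \<le> a" if "v \<in> V" for v
      using y(1) that unfolding K_def B_def by (auto simp: PiE_iff split: if_splits)
    show "(\<Sum>v\<in>V. y v) = s" using y(1) unfolding K_def by auto
    show "edge_density E x \<le> edge_density E y" using y(2)[OF ext[of x]] assms ext_dens by simp
    show "edge_density E z \<le> edge_density E y"
      if "\<And>v. v \<in> V \<Longrightarrow> 0 \<le> z v" "\<And>v. v \<in> V \<Longrightarrow> z v \<le> a" "(\<Sum>v\<in>V. z v) = s" for z
      using y(2)[OF ext[of z]] that ext_dens by simp
  qed
qed

subsection \<open>Bounded weights\<close>

text \<open>At a maximizer, moving a little weight from a heaviest vertex to a lighter one respects
  the cap and cannot raise the density, so the lighter vertex has no larger link density. Euler's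
  identity then bounds the density by the largest link density, attained at a heaviest
  vertex.\<close>

lemma capped_simplex_max_vertex:
  fixes x :: "'a \<Rightarrow> real"
  assumes E: "uniform (Suc r) V E" and "V \<noteq> {}"
    and "\<And>v. v \<in> V \<Longrightarrow> 0 \<le> x v" and "\<And>v. v \<in> V \<Longrightarrow> x v \<le> a" and "(\<Sum>v\<in>V. x v) = s"
  obtains y w where "w \<in> V" and "\<And>v. v \<in> V \<Longrightarrow> 0 \<le> y v" and "\<And>v. v \<in> V \<Longrightarrow> y v \<le> y w"
    and "y w \<le> a" and "(\<Sum>v\<in>V. y v) = s" and "edge_density E x \<le> edge_density E y"
    and "real (Suc r) * edge_density E y \<le> s * edge_density (link_edges E w) y"
proof -
  let ?D = "\<lambda>y v. edge_density (link_edges E v) y"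
  obtain y where y: "\<And>v. v \<in> V \<Longrightarrow> 0 \<le> y v" "\<And>v. v \<in> V \<Longrightarrow> y v \<le> a"
    "(\<Sum>v\<in>V. y v) = s" "edge_density E x \<le> edge_density E y"
    "\<And>z. \<lbrakk>\<And>v. v \<in> V \<Longrightarrow> 0 \<le> z v; \<And>v. v \<in> V \<Longrightarrow> z v \<le> a; (\<Sum>v\<in>V. z v) = s\<rbrakk>
      \<Longrightarrow> edge_density E z \<le> edge_density E y"
    using capped_simplex_maximizer[OF E assms(3-5)] by metis
  have finV: "finite V" using E by (auto simp: uniform_def)
  define c where "c = Max (y ` V)"
  have le_c: "y v \<le> c" if "v \<in> V" for v using that finV by (simp add: c_def)
  have "c \<in> y ` V" using finV \<open>V \<noteq> {}\<close> by (simp add: c_def)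
  \<comment> \<open>Between two heaviest vertices no weight can be moved when \<open>c\<close>
    equals the cap. Ties are therefore broken in favour of the largest link density.\<close>
  define W where "W = {v \<in> V. y v = c}"
  have W: "finite W" "W \<noteq> {}" using \<open>c \<in> y ` V\<close> finV by (auto simp: W_def)
  have "Max (?D y ` W) \<in> ?D y ` W" using W by (intro Max_in) auto
  then obtain w where w: "w \<in> W" "?D y w = Max (?D y ` W)" by auto
  have wV: "w \<in> V" "y w = c" using w by (auto simp: W_def)
  have D_le: "?D y u \<le> ?D y w" if u: "u \<in> V" for u
  proof (cases "y u = c")
    case True
    then have "?D y u \<in> ?D y ` W" using u by (auto simp: W_def)
    then show ?thesis using w W by simp
  next
    case False
    then have lt: "y u < c" using le_c[OF u] by simp
    then have "u \<noteq> w" using wV by auto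
    let ?B = "edge_density (link_edges (link_edges E w) u) y"
    have shift: "?D y u - ?D y w \<le> h * ?B" if h: "0 < h" "h \<le> c - y u" for h
    proof -
      let ?z = "y(u := y u + h, w := y w - h)"
      have "edge_density E ?z \<le> edge_density E y"
      proof (rule y(5))
        show "0 \<le> ?z v" "?z v \<le> a" if "v \<in> V" for v
          using that h y(1)[OF that] y(1)[OF u] y(2)[OF that] y(2)[OF wV(1)] wV
          by (auto split: if_splits)
        have "(\<Sum>v\<in>V. ?z v) = (\<Sum>v\<in>V. y v + (if v = u then h else 0) - (if v = w then h else 0))"
          using \<open>u \<noteq> w\<close> by (intro sum.cong) auto
        also have "\<dots> = s" using y(3) u wV finV by (simp add: sum.distrib sum_subtractf)
        finally show "(\<Sum>v\<in>V. ?z v) = s" .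
      qed
      then have "h * (?D y u - ?D y w) \<le> h * (h * ?B)"
        using edge_density_shift[OF E \<open>u \<noteq> w\<close>, of y h] by (simp add: power2_eq_square)
      then show ?thesis using h(1) by simp
    qed
    show ?thesis
    proof (rule ccontr)
      assume "\<not> ?thesis"
      then have pos: "0 < ?D y u - ?D y w" by simp
      \<comment> \<open>The shift is small enough that the quadratic term eats at most half of the
        assumed first-order gain; adding 1 avoids a zero denominator.\<close>
      define h where "h = min (c - y u) ((?D y u - ?D y w) / (2 * (\<bar>?B\<bar> + 1)))"
      have h: "0 < h" "h \<le> c - y u" using lt pos by (auto simp: h_def)
      have "h * ?B \<le> h * (\<bar>?B\<bar> + 1)" using h(1) by simp
      also have "\<dots> \<le> (?D y u - ?D y w) / (2 * (\<bar>?B\<bar> + 1)) * (\<bar>?B\<bar> + 1)"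
        by (rule mult_right_mono) (auto simp: h_def)
      also have "\<dots> = (?D y u - ?D y w) / 2" by (simp add: field_simps)
      finally show False using shift[OF h] pos by simp
    qed
  qed
  have "real (Suc r) * edge_density E y = (\<Sum>v\<in>V. y v * ?D y v)"
    using sum_edge_density_link[OF E] by simp
  also have "\<dots> \<le> (\<Sum>v\<in>V. y v * ?D y w)"
    by (intro sum_mono mult_left_mono D_le y(1))
  also have "\<dots> = s * ?D y w" using y(3) by (simp add: sum_distrib_right[symmetric])
  finally show thesis
    using that[of w y] y wV le_c by (metis (no_types, lifting))
qed

text \<open>The form in which the forbidden expansion enters the estimates: unlike freeness from a
  fixed hypergraph, it passes to links with the same \<open>d\<close> while the uniformity drops by
  one. The set \<open>I\<close> is the one whose link graph is counted on \<open>A\<close>.\<close>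

definition link_sparse :: "nat \<Rightarrow> nat \<Rightarrow> 'a set \<Rightarrow> 'a set set \<Rightarrow> bool" where
  "link_sparse d r V E \<longleftrightarrow> uniform r V E \<and>
     (\<forall>I A. I \<subseteq> V \<longrightarrow> A \<subseteq> V \<longrightarrow> I \<inter> A = {} \<longrightarrow> card I + 2 = r \<longrightarrow>
        2 * card {e. e \<subseteq> A \<and> card e = 2 \<and> I \<union> e \<in> E} \<le> d * card A)"

lemma link_sparse_uniform: "link_sparse d r V E \<Longrightarrow> uniform r V E"
  by (simp add: link_sparse_def)

lemma link_sparse_link:
  assumes E: "link_sparse d (Suc r) V E" and w: "w \<in> V"
  shows "link_sparse d r (V - {w}) (link_edges E w)"
  unfolding link_sparse_def
proof (intro conjI allI impI)
  show "uniform r (V - {w}) (link_edges E w)"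
    by (rule uniform_link[OF link_sparse_uniform[OF E]])
  fix I A assume IA: "I \<subseteq> V - {w}" "A \<subseteq> V - {w}" "I \<inter> A = {}" "card I + 2 = r"
  have "finite I" using IA(1) link_sparse_uniform[OF E] finite_subset by (auto simp: uniform_def)
  moreover have "w \<notin> I" using IA(1) by auto
  ultimately have "card (insert w I) + 2 = Suc r" using IA(4) by simp
  then have "2 * card {e. e \<subseteq> A \<and> card e = 2 \<and> insert w I \<union> e \<in> E} \<le> d * card A"
    using E[unfolded link_sparse_def, THEN conjunct2, rule_format, of "insert w I" A] IA w
    by auto
  moreover have "{e. e \<subseteq> A \<and> card e = 2 \<and> I \<union> e \<in> link_edges E w} =
      {e. e \<subseteq> A \<and> card e = 2 \<and> insert w I \<union> e \<in> E}"
    using IA by (auto simp: link_edges_def)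
  ultimately show "2 * card {e. e \<subseteq> A \<and> card e = 2 \<and> I \<union> e \<in> link_edges E w} \<le> d * card A"
    by simp
qed

lemma link_sparse_graph_edges:
  assumes "link_sparse d 2 V E" and "A \<subseteq> V"
  shows "real (card {e \<in> E. e \<subseteq> A}) \<le> real d / 2 * real (card A)"
proof -
  have "{e. e \<subseteq> A \<and> card e = 2 \<and> {} \<union> e \<in> E} = {e \<in> E. e \<subseteq> A}"
    using link_sparse_uniform[OF assms(1)] by (auto simp: uniform_def)
  then have "2 * card {e \<in> E. e \<subseteq> A} \<le> d * card A"
    using assms(1)[unfolded link_sparse_def, THEN conjunct2, rule_format, of "{}" A] assms(2)
    by simp
  then have "real (2 * card {e \<in> E. e \<subseteq> A}) \<le> real (d * card A)" by (rule of_nat_mono)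
  then show ?thesis by simp
qed

text \<open>A product of two weights is their maximum times their minimum. Bounding the maximum by
  the cap leaves the minima that \<open>sum_Min_le\<close> controls.\<close>

lemma graph_edge_density_le_sum_Min:
  assumes E: "uniform 2 V E"
    and "\<And>v. v \<in> V \<Longrightarrow> 0 \<le> x v" and "\<And>v. v \<in> V \<Longrightarrow> x v \<le> a"
  shows "edge_density E x \<le> a * (\<Sum>e\<in>E. Min (x ` e))"
  unfolding edge_density_def sum_distrib_left
proof (rule sum_mono)
  fix e assume "e \<in> E"
  then have "card e = 2" "e \<subseteq> V" using E by (auto simp: uniform_def)
  then obtain u v where uv: "e = {u, v}" "u \<noteq> v" "u \<in> V" "v \<in> V" by (auto simp: card_2_iff)
  have "x u * x v = max (x u) (x v) * min (x u) (x v)" by (simp add: max_def min_def)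
  also have "\<dots> \<le> a * min (x u) (x v)" using assms uv by (intro mult_right_mono) auto
  finally show "(\<Prod>v\<in>e. x v) \<le> a * Min (x ` e)" using uv by simp
qed

text \<open>Weierstrass's product inequality, which generalises Bernoulli's to different
  factors.\<close>

lemma one_minus_sum_le_prod:
  fixes f :: "'a \<Rightarrow> real"
  assumes "finite A" and "\<And>i. i \<in> A \<Longrightarrow> 0 \<le> f i" and "\<And>i. i \<in> A \<Longrightarrow> f i \<le> 1"
  shows "1 - (\<Sum>i\<in>A. f i) \<le> (\<Prod>i\<in>A. 1 - f i)"
  using assms
proof (induction A rule: finite_induct)
  case (insert i A)
  have "f i * (\<Prod>i\<in>A. 1 - f i) \<le> f i * 1"
    using insert.prems by (intro mult_left_mono prod_le_1) auto
  then show ?case using insert by (simp add: left_diff_distrib) 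
qed simp

section \<open>The bounding polynomial and its growth in the cap\<close>

definition cap_poly :: "nat \<Rightarrow> real \<Rightarrow> real \<Rightarrow> real" where
  "cap_poly k s a = a * (\<Prod>i<k. s - real i * a)"

lemma cap_poly_nonneg:
  assumes "0 \<le> a" and "real k * a \<le> s"
  shows "0 \<le> cap_poly k s a"
proof -
  have "real i * a \<le> s" if "i < k" for i
  proof -
    have "real i * a \<le> real k * a" using that assms by (intro mult_right_mono) auto
    then show ?thesis using assms by simp
  qed
  then show ?thesis unfolding cap_poly_def using assms by (intro mult_nonneg_nonneg prod_nonneg) auto
qed

text \<open>The recursion mirrors the passage to a link: removing a vertex of weight
  \<open>a\<close> leaves total weight \<open>s - a\<close>, and averaging over all vertices
  contributes the factor \<open>s\<close>.\<close>

lemma cap_poly_Suc: "s * cap_poly k (s - a) a = cap_poly (Suc k) s a"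
proof -
  have "(\<Prod>i<Suc k. s - real i * a) = s * (\<Prod>i<k. s - a - real i * a)"
    by (simp add: prod.lessThan_Suc_shift algebra_simps del: prod.lessThan_Suc)
  then show ?thesis by (simp add: cap_poly_def del: prod.lessThan_Suc)
qed

lemma cap_poly_scale: "cap_poly k (c * s) (c * a) = c ^ Suc k * cap_poly k s a"
proof -
  have "(\<Prod>i<k. c * s - real i * (c * a)) = (\<Prod>i<k. c * (s - real i * a))"
    by (intro prod.cong) (auto simp: algebra_simps)
  then show ?thesis by (simp add: cap_poly_def prod.distrib)
qed

text \<open>The additional factor makes the monotonicity in \<open>a\<close> quantitative, as needed for stability.\<close>

lemma cap_poly_growth:
  assumes "0 \<le> c" "c \<le> a" "0 < a" and "real (d + k) * a \<le> s" and "2 * k\<^sup>2 \<le> d"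
  shows "cap_poly k s c \<le> cap_poly k s a * (1 - (a - c) / (2 * a))"
proof -
  let ?P = "\<lambda>c. \<Prod>i<k. s - real i * c"
  have low: "(real d + 1) * a \<le> s - real i * b" if "i < k" "0 \<le> b" "b \<le> a" for i b
  proof -
    have "real i * b \<le> (real k - 1) * a" using that by (intro mult_mono) auto
    then show ?thesis using assms(4) by (simp add: algebra_simps)
  qed
  have pos: "0 < s - real i * b" if "i < k" "0 \<le> b" "b \<le> a" for i b
    using low[OF that] mult_pos_pos[of "real d + 1" a] assms(3) by linarith
  \<comment> \<open>The relative loss of the factor with index \<open>i\<close> when
    \<open>c\<close> is raised to \<open>a\<close>.\<close>
  define u where "u = (\<lambda>i. real i * (a - c) / (s - real i * c))"
  have u0: "0 \<le> u i" if "i < k" for i using pos[OF that assms(1,2)] assms by (simp add: u_def)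
  have u1: "1 - u i = (s - real i * a) / (s - real i * c)" if "i < k" for i
    using pos[OF that assms(1,2)] by (simp add: u_def field_simps)
  have "u i \<le> real k * (a - c) / ((real d + 1) * a)" if "i < k" for i
    unfolding u_def using that assms low[OF that assms(1,2)]
    by (intro frac_le mult_right_mono mult_nonneg_nonneg) (auto intro!: mult_pos_pos)
  then have "(\<Sum>i<k. u i) \<le> real k * (real k * (a - c) / ((real d + 1) * a))"
    using sum_bounded_above[of "{..<k}" u "real k * (a - c) / ((real d + 1) * a)"] by simp
  also have "\<dots> = (real k)\<^sup>2 / (real d + 1) * ((a - c) / a)"
    by (simp add: power2_eq_square)
  \<comment> \<open>Here \<open>d\<close> must be large compared with the square of
    \<open>k\<close>: the losses of all factors together are then at most half the relative gain in
    the leading factor.\<close>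
  also have "\<dots> \<le> 1 / 2 * ((a - c) / a)"
  proof (rule mult_right_mono)
    have "real (2 * k\<^sup>2) \<le> real d" using assms(5) by (rule of_nat_mono)
    then show "(real k)\<^sup>2 / (real d + 1) \<le> 1 / 2" by (simp add: field_simps)
  qed (use assms in auto)
  finally have "1 - (a - c) / (2 * a) \<le> 1 - (\<Sum>i<k. u i)" by simp
  also have "\<dots> \<le> (\<Prod>i<k. 1 - u i)"
  proof (rule one_minus_sum_le_prod)
    show "u i \<le> 1" if "i \<in> {..<k}" for i
    proof -
      have "0 \<le> 1 - u i" using u1[of i] that pos[of i c] pos[of i a] assms by simp
      then show ?thesis by simp
    qed
  qed (use u0 in auto)
  also have "\<dots> = ?P a / ?P c" using u1 by (simp add: prod_dividef)
  finally have key: "?P c * (1 - (a - c) / (2 * a)) \<le> ?P a"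
  proof -
    assume "1 - (a - c) / (2 * a) \<le> ?P a / ?P c"
    moreover have "0 < ?P c" using pos assms by (intro prod_pos) auto
    ultimately show ?thesis by (simp add: pos_le_divide_eq mult.commute)
  qed
  let ?q = "1 - (a - c) / (2 * a)"
  have "0 \<le> ?P c" using pos assms by (intro prod_nonneg) (auto intro: less_imp_le)
  \<comment> \<open>As \<open>?q\<close> is \<open>(a + c) / (2 * a)\<close>, this is the inequality
    between arithmetic and geometric mean. One factor \<open>?q\<close> pays for the loss in the
    product, the other is the quantitative gain.\<close>
  moreover have "c \<le> a * ?q * ?q"
  proof -
    have "a * ?q * ?q - c = (a - c)\<^sup>2 / (4 * a)"
      using assms by (simp add: field_simps power2_eq_square)
    moreover have "0 \<le> (a - c)\<^sup>2 / (4 * a)" using assms by simp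
    ultimately show ?thesis by linarith
  qed
  ultimately have "c * ?P c \<le> a * ?q * ?q * ?P c" by (rule mult_right_mono[rotated])
  also have "\<dots> = a * ?q * (?P c * ?q)" by simp
  also have "\<dots> \<le> a * ?q * ?P a"
    using key assms by (intro mult_left_mono) (auto simp: field_simps)
  finally show ?thesis by (simp add: cap_poly_def algebra_simps)
qed

lemma cap_poly_mono:
  assumes "0 \<le> c" "c \<le> a" and "real (d + k) * a \<le> s" and "2 * k\<^sup>2 \<le> d"
  shows "cap_poly k s c \<le> cap_poly k s a"
proof (cases "a = 0")
  case False
  then have a: "0 < a" using assms by simp
  have "real k * a \<le> real (d + k) * a" using a by simp
  then have "0 \<le> cap_poly k s a" using a assms(3) by (intro cap_poly_nonneg) linarith+
  then have "cap_poly k s a * (1 - (a - c) / (2 * a)) \<le> cap_poly k s a * 1"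
    using a assms by (intro mult_left_mono) auto
  then show ?thesis using cap_poly_growth[OF assms(1,2) a assms(3,4)] by simp
qed (use assms in simp)

text \<open>For graphs this combines \<open>graph_edge_density_le_sum_Min\<close> with
  \<open>sum_Min_le\<close> for the constant \<open>d / 2\<close>. In the induction step the link of
  a heaviest vertex is bounded with the weight of that vertex as cap; \<open>cap_poly_Suc\<close>
  and monotonicity in the cap return to \<open>a\<close>.\<close>

lemma edge_density_le_cap_poly:
  assumes "link_sparse d (Suc (Suc k)) V E" and "2 * (Suc k)\<^sup>2 \<le> d"
    and "\<And>v. v \<in> V \<Longrightarrow> 0 \<le> x v" and "\<And>v. v \<in> V \<Longrightarrow> x v \<le> a" and "(\<Sum>v\<in>V. x v) = s"
    and "0 \<le> a" and "real (d + Suc k) * a \<le> s"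
  shows "edge_density E x \<le> real d / fact (Suc (Suc k)) * cap_poly (Suc k) s a"
  using assms
proof (induction k arbitrary: V E x s a)
  case 0
  have E2: "link_sparse d 2 V E" using 0(1) by (simp add: numeral_2_eq_2)
  have "(\<Sum>e\<in>E. Min (x ` e)) \<le> real d / 2 * s"
    unfolding 0(5)[symmetric]
  proof (rule sum_Min_le)
    show "finite V" using link_sparse_uniform[OF E2] by (simp add: uniform_def)
    show "e \<subseteq> V \<and> e \<noteq> {}" if "e \<in> E" for e
      using that link_sparse_uniform[OF E2] by (auto simp: uniform_def)
  qed (use link_sparse_graph_edges[OF E2] 0 in auto)
  then have "a * (\<Sum>e\<in>E. Min (x ` e)) \<le> a * (real d / 2 * s)"
    using 0 by (intro mult_left_mono) auto
  moreover have "edge_density E x \<le> a * (\<Sum>e\<in>E. Min (x ` e))"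
    using graph_edge_density_le_sum_Min[OF link_sparse_uniform[OF E2], of x a] 0 by simp
  ultimately show ?case by (simp add: cap_poly_def mult_ac)
next
  case (Suc k)
  note E = link_sparse_uniform[OF Suc.prems(1)]
  show ?case
  proof (cases "V = {}")
    case True
    have "E = {}"
    proof -
      have "e = {} \<and> card e = Suc (Suc (Suc k))" if "e \<in> E" for e
        using E that True by (auto simp: uniform_def)
      then show ?thesis by fastforce
    qed
    moreover have "real (Suc (Suc k)) * a \<le> real (d + Suc (Suc k)) * a"
      using Suc.prems by (intro mult_right_mono) auto
    then have "0 \<le> cap_poly (Suc (Suc k)) s a"
      using Suc.prems(6,7) by (intro cap_poly_nonneg) linarith+
    ultimately show ?thesis by (simp add: edge_density_def del: fact_Suc)
  next
    case False
    obtain y w where yw: "w \<in> V" "\<And>v. v \<in> V \<Longrightarrow> 0 \<le> y v" "\<And>v. v \<in> V \<Longrightarrow> y v \<le> y w"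
      "y w \<le> a" "(\<Sum>v\<in>V. y v) = s" "edge_density E x \<le> edge_density E y"
      "real (Suc (Suc (Suc k))) * edge_density E y \<le> s * edge_density (link_edges E w) y"
      using capped_simplex_max_vertex[OF E False Suc.prems(3-5)] by metis
    have finV: "finite V" using E by (simp add: uniform_def)
    have cap: "real (d + Suc (Suc k)) * y w \<le> s"
      using mult_left_mono[OF yw(4), of "real (d + Suc (Suc k))"] Suc.prems(7) by linarith
    have k: "2 * (Suc k)\<^sup>2 \<le> d"
      using Suc.prems(2) power_mono[of "Suc k" "Suc (Suc k)" 2] by linarith
    have "edge_density (link_edges E w) y \<le>
        real d / fact (Suc (Suc k)) * cap_poly (Suc k) (s - y w) (y w)"
    proof (rule Suc.IH[OF link_sparse_link[OF Suc.prems(1) yw(1)] k])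
      show "(\<Sum>v\<in>V - {w}. y v) = s - y w" using yw finV by (simp add: sum_diff1)
      \<comment> \<open>The cap condition is inherited: the total drops by \<open>y w\<close>, and
        the required multiple of \<open>y w\<close> drops by one.\<close>
      show "real (d + Suc k) * y w \<le> s - y w" using cap by (simp add: algebra_simps)
    qed (use yw in auto)
    moreover have "0 \<le> s" using yw(2,5) sum_nonneg by metis
    ultimately have "s * edge_density (link_edges E w) y \<le>
        s * (real d / fact (Suc (Suc k)) * cap_poly (Suc k) (s - y w) (y w))"
      by (rule mult_left_mono)
    also have "\<dots> = real d / fact (Suc (Suc k)) * cap_poly (Suc (Suc k)) s (y w)"
      using cap_poly_Suc[of s "Suc k" "y w"] by (simp add: mult.left_commute)
    also have "\<dots> \<le> real d / fact (Suc (Suc k)) * cap_poly (Suc (Suc k)) s a"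
      using cap_poly_mono[OF yw(2)[OF yw(1)] yw(4) Suc.prems(7,2)]
      by (intro mult_left_mono) auto
    finally have "real (Suc (Suc (Suc k))) * edge_density E x \<le>
        real d / fact (Suc (Suc k)) * cap_poly (Suc (Suc k)) s a"
      using yw(6,7) mult_left_mono[OF yw(6), of "real (Suc (Suc (Suc k)))"] by linarith
    moreover have "n * D \<le> real d / f * c \<Longrightarrow> 0 < n \<Longrightarrow> D \<le> real d / (n * f) * c" for n D f c :: real
      using pos_le_divide_eq[of n D "real d / f * c"] by (simp add: mult_ac)
    ultimately show ?thesis
      by (simp only: fact_Suc[of "Suc (Suc k)"] of_nat_mult of_nat_0_less_iff zero_less_Suc)
  qed
qed

subsection \<open>Lagrangians of sparse hypergraphs\<close>

text \<open>
  The index \<open>k\<close> stands for uniformity \<open>k + 1\<close>, so this is the Lagrangian of the complete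
  \<open>(k + 1)\<close>-graph on \<open>d + k\<close> vertices, written in the form of the bound for weights at most
  \<open>1 / (d + k)\<close>.
\<close>

definition clique_lagrangian :: "nat \<Rightarrow> nat \<Rightarrow> real" where
  "clique_lagrangian d k = real d / fact (Suc k) * cap_poly k 1 (1 / real (d + k))"

lemma clique_lagrangian_scale:
  "real d / fact (Suc k) * cap_poly k s (s / real (d + k)) = clique_lagrangian d k * s ^ Suc k"
  using cap_poly_scale[of k s 1 "1 / real (d + k)"]
  by (simp add: clique_lagrangian_def del: fact_Suc)

lemma clique_lagrangian_0: "0 < d \<Longrightarrow> clique_lagrangian d 0 = 1"
  by (simp add: clique_lagrangian_def cap_poly_def)

lemma clique_lagrangian_pos:
  assumes "0 < d"
  shows "0 < clique_lagrangian d k"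
proof -
  have "0 < 1 - real i * (1 / real (d + k))" if "i < k" for i
    using that assms by (simp add: field_simps)
  then have "0 < cap_poly k 1 (1 / real (d + k))"
    unfolding cap_poly_def using assms by (intro mult_pos_pos prod_pos) auto
  then show ?thesis using assms by (simp add: clique_lagrangian_def del: fact_Suc)
qed

text \<open>Under equal weights all links of a clique look alike, so Euler's identity reduces its
  density to that of one link. This link is a clique on one vertex fewer, again equally weighted,
  with total \<open>1 - 1 / real (d + Suc k)\<close>.\<close>

lemma clique_lagrangian_Suc:
  assumes "0 < d"
  shows "real (Suc (Suc k)) * clique_lagrangian d (Suc k) =
    clique_lagrangian d k * (1 - 1 / real (d + Suc k)) ^ Suc k"
proof -
  define a where "a = 1 / real (d + Suc k)"
  have a: "(1 - a) / real (d + k) = a"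
  proof -
    have "real (d + Suc k) = real (d + k) + 1" by simp
    moreover have "0 < real (d + k)" using assms by simp
    moreover have "(1 - 1 / (n + 1)) / n = 1 / (n + 1)" if "0 < n" for n :: real
    proof -
      have "1 - 1 / (n + 1) = n / (n + 1)" using that by (simp add: field_simps)
      then show ?thesis using that by simp
    qed
    ultimately show ?thesis unfolding a_def by metis
  qed
  have "real (Suc (Suc k)) * clique_lagrangian d (Suc k) =
      real d / fact (Suc k) * cap_poly (Suc k) 1 a"
    unfolding clique_lagrangian_def a_def fact_Suc[of "Suc k"]
    by (simp del: fact_Suc of_nat_Suc)
  also have "\<dots> = real d / fact (Suc k) * cap_poly k (1 - a) ((1 - a) / real (d + k))"
    using cap_poly_Suc[of 1 k a] a by simp
  also have "\<dots> = clique_lagrangian d k * (1 - a) ^ Suc k"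
    by (rule clique_lagrangian_scale)
  finally show ?thesis by (simp add: a_def)
qed

lemma link_sparse_empty:
  assumes "link_sparse d (Suc k) {} E"
  shows "edge_density E x = 0"
proof -
  have "e = {} \<and> card e = Suc k" if "e \<in> E" for e
    using link_sparse_uniform[OF assms] that by (auto simp: uniform_def)
  then have "E = {}" by fastforce
  then show ?thesis by (simp add: edge_density_def)
qed

text \<open>Two regimes for a heaviest vertex of a maximizer. Up to the average weight in the
  clique, \<open>edge_density_le_cap_poly\<close> applies and is monotone in the cap. Beyond it, so
  little weight remains for the link that induction and \<open>clique_lagrangian_Suc\<close>
  suffice.\<close>

lemma edge_density_le_clique_lagrangian:
  assumes "link_sparse d (Suc k) V E" and "2 * k\<^sup>2 \<le> d" and "0 < d"
    and "\<And>v. v \<in> V \<Longrightarrow> 0 \<le> x v" and "(\<Sum>v\<in>V. x v) = s"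
  shows "edge_density E x \<le> clique_lagrangian d k * s ^ Suc k"
  using assms
proof (induction k arbitrary: V E x s)
  case 0
  then show ?case
    using edge_density_le_power[OF link_sparse_uniform[OF 0(1)], of x]
    by (simp add: clique_lagrangian_0)
next
  case (Suc k)
  note E = link_sparse_uniform[OF Suc.prems(1)]
  let ?m = "real (d + Suc k)" and ?L = "clique_lagrangian d"
  have finV: "finite V" using E by (simp add: uniform_def)
  have s0: "0 \<le> s" using Suc.prems(4,5) sum_nonneg by metis
  show ?case
  proof (cases "V = {}")
    case True
    have "edge_density E x = 0" using link_sparse_empty Suc.prems(1) True by metis
    then show ?thesis
      using clique_lagrangian_pos[OF Suc.prems(3), of "Suc k"] s0 by simp
  next
    case False
    \<comment> \<open>No weight exceeds the total, so with cap \<open>s\<close> the maximizer ranges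
      over the whole simplex.\<close>
    have "x v \<le> s" if "v \<in> V" for v
      using that Suc.prems(4,5) finV by (metis member_le_sum DiffD1)
    then obtain y w where yw: "w \<in> V" "\<And>v. v \<in> V \<Longrightarrow> 0 \<le> y v" "\<And>v. v \<in> V \<Longrightarrow> y v \<le> y w"
      "y w \<le> s" "(\<Sum>v\<in>V. y v) = s" "edge_density E x \<le> edge_density E y"
      "real (Suc (Suc k)) * edge_density E y \<le> s * edge_density (link_edges E w) y"
      using capped_simplex_max_vertex[OF E False Suc.prems(4) _ Suc.prems(5), of s] by metis
    show ?thesis
    proof (cases "?m * y w \<le> s")
      case True
      have "edge_density E y \<le> real d / fact (Suc (Suc k)) * cap_poly (Suc k) s (y w)"
        using edge_density_le_cap_poly[OF Suc.prems(1,2), of y "y w" s] yw True by blast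
      also have "\<dots> \<le> real d / fact (Suc (Suc k)) * cap_poly (Suc k) s (s / ?m)"
      proof (intro mult_left_mono cap_poly_mono)
        show "y w \<le> s / ?m" using True Suc.prems(3) by (simp add: field_simps)
        show "?m * (s / ?m) \<le> s" using Suc.prems(3) by simp
      qed (use yw Suc.prems in auto)
      also have "\<dots> = ?L (Suc k) * s ^ Suc (Suc k)" by (rule clique_lagrangian_scale)
      finally show ?thesis using yw(6) by simp
    next
      case False
      have k: "2 * k\<^sup>2 \<le> d"
        using Suc.prems(2) power_mono[of k "Suc k" 2] by linarith
      have "edge_density (link_edges E w) y \<le> ?L k * (s - y w) ^ Suc k"
        using yw finV
        by (intro Suc.IH[OF link_sparse_link[OF Suc.prems(1) yw(1)] k Suc.prems(3)])
          (auto simp: sum_diff1)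
      also have "\<dots> \<le> ?L k * (s * (1 - 1 / ?m)) ^ Suc k"
      proof (intro mult_left_mono power_mono)
        have "s / ?m \<le> y w" using False Suc.prems(3) by (simp add: pos_divide_le_eq mult.commute)
        then show "s - y w \<le> s * (1 - 1 / ?m)" by (simp add: right_diff_distrib)
      qed (use yw clique_lagrangian_pos[OF Suc.prems(3), of k] in auto)
      also have "\<dots> = s ^ Suc k * (real (Suc (Suc k)) * ?L (Suc k))"
        unfolding clique_lagrangian_Suc[OF Suc.prems(3)] power_mult_distrib by (rule mult.left_commute)
      finally have "s * edge_density (link_edges E w) y \<le>
          s * (s ^ Suc k * (real (Suc (Suc k)) * ?L (Suc k)))"
        using s0 by (rule mult_left_mono)
      then have "real (Suc (Suc k)) * edge_density E y \<le>
          real (Suc (Suc k)) * (?L (Suc k) * s ^ Suc (Suc k))"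
        using yw(7) by (simp only: power_Suc mult_ac)
      then have "edge_density E y \<le> ?L (Suc k) * s ^ Suc (Suc k)"
        by (rule mult_left_le_imp_le) simp
      then show ?thesis using yw(6) by simp
    qed
  qed
qed

section \<open>Heaviest vertices of near-optimal weightings\<close>

definition weighted_sparse :: "nat \<Rightarrow> nat \<Rightarrow> 'a set \<Rightarrow> 'a set set \<Rightarrow> ('a \<Rightarrow> real) \<Rightarrow> bool" where
  "weighted_sparse d k V E x \<longleftrightarrow>
     link_sparse d (Suc k) V E \<and> (\<forall>v\<in>V. 0 \<le> x v) \<and> (\<Sum>v\<in>V. x v) = 1"

text \<open>With the heaviest weight as cap, a relative shortfall \<open>e\<close> below
  \<open>1 / real (d + Suc k)\<close> costs a factor \<open>1 - e / 2\<close> by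
  \<open>cap_poly_growth\<close>. Near-optimality limits this loss to \<delta>.\<close>

lemma weighted_sparse_max_vertex_ge:
  assumes W: "weighted_sparse d (Suc k) V E x" and d: "2 * (Suc k)\<^sup>2 \<le> d" "0 < d"
    and u: "u \<in> V" "\<And>v. v \<in> V \<Longrightarrow> x v \<le> x u"
    and \<delta>: "clique_lagrangian d (Suc k) - \<delta> \<le> edge_density E x" "0 \<le> \<delta>"
  shows "1 / real (d + Suc k) - 2 * \<delta> / (real (d + Suc k) * clique_lagrangian d (Suc k)) \<le> x u"
proof -
  let ?m = "real (d + Suc k)" and ?L = "clique_lagrangian d (Suc k)"
  have E: "link_sparse d (Suc (Suc k)) V E" and x0: "\<And>v. v \<in> V \<Longrightarrow> 0 \<le> x v"
    and x1: "(\<Sum>v\<in>V. x v) = 1" using W by (auto simp: weighted_sparse_def)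
  have m: "0 < ?m" and L: "0 < ?L" using d clique_lagrangian_pos by auto
  show ?thesis
  proof (cases "1 / ?m \<le> x u")
    case True
    then show ?thesis using m L \<delta>(2) by (smt (verit) divide_nonneg_pos mult_pos_pos)
  next
    case False
    then have xu: "?m * x u \<le> 1" using m by (simp add: field_simps)
    let ?q = "1 - (1 / ?m - x u) / (2 * (1 / ?m))"
    have "edge_density E x \<le> real d / fact (Suc (Suc k)) * cap_poly (Suc k) 1 (x u)"
      by (rule edge_density_le_cap_poly[OF E d(1) x0 u(2) x1 x0[OF u(1)] xu])
    also have "\<dots> \<le> real d / fact (Suc (Suc k)) * (cap_poly (Suc k) 1 (1 / ?m) * ?q)"
      using m False x0[OF u(1)] d by (intro mult_left_mono cap_poly_growth) auto
    also have "\<dots> = ?L * ?q" by (simp add: clique_lagrangian_def)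
    finally have "edge_density E x \<le> ?L * ?q" .
    moreover define e where "e = (1 / ?m - x u) * ?m"
    have "?q = 1 - e / 2" by (simp add: e_def)
    ultimately have "?L - \<delta> \<le> ?L * (1 - e / 2)" using \<delta>(1) by (metis order_trans)
    then have "?L * e \<le> 2 * \<delta>" by (simp add: right_diff_distrib)
    then have "1 / ?m - x u \<le> 2 * \<delta> / (?m * ?L)"
      using m L by (simp add: pos_le_divide_eq mult_ac e_def)
    then show ?thesis by simp
  qed
qed

text \<open>Moving weight \<open>h\<close> from \<open>u\<close> to \<open>v\<close> cannot beat the
  optimum, hence gains at most the deficit, which is at most the square of \<open>h\<close>. The
  quadratic term of the shift has the same order, so no link density exceeds that of
  \<open>u\<close> by more than \<open>2 * h\<close>, and Euler's identity averages this.\<close>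

lemma weighted_sparse_max_vertex_link:
  assumes W: "weighted_sparse d (Suc k) V E x" and d: "2 * (Suc k)\<^sup>2 \<le> d" "0 < d"
    and u: "u \<in> V" and h: "0 < h" "h \<le> x u"
    and \<delta>: "clique_lagrangian d (Suc k) - h\<^sup>2 \<le> edge_density E x"
  shows "real (Suc (Suc k)) * edge_density E x \<le> edge_density (link_edges E u) x + 2 * h"
proof -
  let ?D = "\<lambda>v. edge_density (link_edges E v) x"
  have E: "link_sparse d (Suc (Suc k)) V E" and x0: "\<And>v. v \<in> V \<Longrightarrow> 0 \<le> x v"
    and x1: "(\<Sum>v\<in>V. x v) = 1" using W by (auto simp: weighted_sparse_def)
  note unif = link_sparse_uniform[OF E]
  have finV: "finite V" using unif by (simp add: uniform_def)
  have D_le: "?D v \<le> ?D u + 2 * h" if v: "v \<in> V" for v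
  proof (cases "v = u")
    case False
    let ?z = "x(v := x v + h, u := x u - h)"
    let ?B = "edge_density (link_edges (link_edges E u) v) x"
    have "(\<Sum>w\<in>V. ?z w) = (\<Sum>w\<in>V. x w + (if w = v then h else 0) - (if w = u then h else 0))"
      using False by (intro sum.cong) auto
    also have "\<dots> = 1" using x1 u v finV by (simp add: sum.distrib sum_subtractf)
    finally have "edge_density E ?z \<le> clique_lagrangian d (Suc k) * 1 ^ Suc (Suc k)"
      using x0 h v by (intro edge_density_le_clique_lagrangian[OF E d]) (auto split: if_splits)
    then have "h * (?D v - ?D u) - h\<^sup>2 * ?B \<le> h\<^sup>2"
      using edge_density_shift[OF unif False, of x h] \<delta> by simp
    moreover have "?B \<le> 1"
    proof -
      have "?B \<le> (\<Sum>w\<in>V - {u} - {v}. x w) ^ k"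
        using edge_density_le_power[OF uniform_link[OF uniform_link[OF unif]]] x0 by simp
      also have "\<dots> \<le> 1 ^ k"
        unfolding x1[symmetric] using x0 finV by (intro power_mono sum_mono2 sum_nonneg) auto
      finally show ?thesis by simp
    qed
    then have "h\<^sup>2 * ?B \<le> h\<^sup>2" using mult_left_mono[of ?B 1 "h\<^sup>2"] by simp
    ultimately have "h * (?D v - ?D u) \<le> h * (2 * h)" by (simp add: power2_eq_square)
    then show ?thesis using h(1) by simp
  qed (use h in simp)
  have "real (Suc (Suc k)) * edge_density E x = (\<Sum>v\<in>V. x v * ?D v)"
    using sum_edge_density_link[OF unif] by simp
  also have "\<dots> \<le> (\<Sum>v\<in>V. x v * (?D u + 2 * h))"
    by (intro sum_mono mult_left_mono D_le x0)
  also have "\<dots> = ?D u + 2 * h" using x1 by (simp add: sum_distrib_right[symmetric])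
  finally show ?thesis .
qed

text \<open>The choice of \<delta> depends only on \<open>d\<close>, \<open>k\<close> and \<eta>,
  uniformly in the hypergraph and its weighting. The two preceding lemmas give the lower bounds; the
  upper bound on \<open>x u\<close> follows because an overweight vertex leaves too little weight
  for its link.\<close>

lemma weighted_sparse_near_optimal:
  assumes d: "2 * (Suc k)\<^sup>2 \<le> d" "0 < d" and \<eta>: "0 < \<eta>"
  obtains \<delta> where "0 < \<delta>"
    and "\<And>V E (x :: 'a \<Rightarrow> real) u. \<lbrakk>weighted_sparse d (Suc k) V E x; u \<in> V; \<And>v. v \<in> V \<Longrightarrow> x v \<le> x u;
        clique_lagrangian d (Suc k) - \<delta> \<le> edge_density E x\<rbrakk> \<Longrightarrow>
      1 / real (d + Suc k) - \<eta> \<le> x u \<and> x u \<le> 1 / real (d + Suc k) + \<eta> \<and>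
      real (Suc (Suc k)) * clique_lagrangian d (Suc k) - \<eta> \<le> edge_density (link_edges E u) x"
proof -
  let ?m = "real (d + Suc k)" and ?L = "clique_lagrangian d (Suc k)"
  \<comment> \<open>\<open>b\<close> bounds the weight left for the link if \<open>x u\<close> were
    too large, and \<tau> is the resulting deficit in link density. The maximum with 0 covers large
    \<eta>.\<close>
  define b where "b = max 0 (1 - 1 / ?m - \<eta>)"
  define \<tau> where "\<tau> = clique_lagrangian d k * ((1 - 1 / ?m) ^ Suc k - b ^ Suc k)"
  have m: "1 < ?m" using d by simp
  have L: "0 < ?L" "0 < clique_lagrangian d k" using clique_lagrangian_pos d by auto
  have b: "0 \<le> b" "b < 1 - 1 / ?m" using m \<eta> by (auto simp: b_def)
  then have "b ^ Suc k < (1 - 1 / ?m) ^ Suc k" by (intro power_strict_mono) auto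
  then have \<tau>: "0 < \<tau>" using L by (simp add: \<tau>_def)
  have "((\<lambda>\<delta>. 2 * \<delta> / (?m * ?L)) \<longlongrightarrow> 2 * 0 / (?m * ?L)) (at_right 0)"
    using m L by (intro tendsto_intros) auto
  \<comment> \<open>The bound \<open>1 / (2 * ?m)\<close>, here and for the root below, guarantees
    \<open>sqrt \<delta> \<le> x u\<close>, so that weight \<open>sqrt \<delta>\<close> may be moved
    away from \<open>u\<close>.\<close>
  then have ev1: "eventually (\<lambda>\<delta>. 2 * \<delta> / (?m * ?L) < min \<eta> (1 / (2 * ?m))) (at_right 0)"
    using \<eta> m by (intro order_tendstoD) auto
  have "((\<lambda>\<delta>. sqrt \<delta>) \<longlongrightarrow> sqrt 0) (at_right 0)"
    by (intro tendsto_intros)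
  then have ev2: "eventually (\<lambda>\<delta>. sqrt \<delta> < 1 / (2 * ?m)) (at_right 0)"
    using m by (intro order_tendstoD) auto
  have "((\<lambda>\<delta>. real (Suc (Suc k)) * \<delta> + 2 * sqrt \<delta>) \<longlongrightarrow> real (Suc (Suc k)) * 0 + 2 * sqrt 0) (at_right 0)"
    by (intro tendsto_intros)
  then have ev3: "eventually (\<lambda>\<delta>. real (Suc (Suc k)) * \<delta> + 2 * sqrt \<delta> < min \<eta> \<tau>) (at_right 0)"
    using \<eta> \<tau> by (intro order_tendstoD) auto
  have "eventually (\<lambda>\<delta>::real. 0 < \<delta>) (at_right 0)" by (rule eventually_at_right_less)
  with ev1 ev2 ev3 have "eventually (\<lambda>\<delta>. 0 < \<delta> \<and> 2 * \<delta> / (?m * ?L) < min \<eta> (1 / (2 * ?m)) \<and>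
      sqrt \<delta> < 1 / (2 * ?m) \<and> real (Suc (Suc k)) * \<delta> + 2 * sqrt \<delta> < min \<eta> \<tau>) (at_right 0)"
    by eventually_elim blast
  then obtain \<delta> where \<delta>: "0 < \<delta>" "2 * \<delta> / (?m * ?L) < min \<eta> (1 / (2 * ?m))"
    "sqrt \<delta> < 1 / (2 * ?m)" "real (Suc (Suc k)) * \<delta> + 2 * sqrt \<delta> < min \<eta> \<tau>"
    using eventually_happens'[OF trivial_limit_at_right_real] by blast
  show thesis
  proof (rule that[OF \<delta>(1)])
    fix V E u and x :: "'a \<Rightarrow> real"
    assume W: "weighted_sparse d (Suc k) V E x" and u: "u \<in> V" "\<And>v. v \<in> V \<Longrightarrow> x v \<le> x u"
      and p: "?L - \<delta> \<le> edge_density E x"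
    let ?D = "edge_density (link_edges E u) x"
    have E: "link_sparse d (Suc (Suc k)) V E" and x0: "\<And>v. v \<in> V \<Longrightarrow> 0 \<le> x v"
      and x1: "(\<Sum>v\<in>V. x v) = 1" using W by (auto simp: weighted_sparse_def)
    have finV: "finite V" using link_sparse_uniform[OF E] by (simp add: uniform_def)
    have low: "1 / ?m - 2 * \<delta> / (?m * ?L) \<le> x u"
      using \<delta>(1) by (intro weighted_sparse_max_vertex_ge[OF W d u p]) auto
    moreover have "1 / ?m = 1 / (2 * ?m) + 1 / (2 * ?m)" by (simp add: field_simps)
    moreover have "s \<le> c" if "a - b \<le> c" "a = q + q" "b < min \<eta> q" "s < q" for a b c q s :: real
      using that by simp
    ultimately have "sqrt \<delta> \<le> x u" using \<delta>(2,3) by blast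
    then have "real (Suc (Suc k)) * edge_density E x \<le> ?D + 2 * sqrt \<delta>"
      using \<delta>(1) p by (intro weighted_sparse_max_vertex_link[OF W d u(1)]) auto
    moreover have "real (Suc (Suc k)) * (?L - \<delta>) \<le> real (Suc (Suc k)) * edge_density E x"
      using p by (intro mult_left_mono) auto
    ultimately have D: "real (Suc (Suc k)) * ?L - (real (Suc (Suc k)) * \<delta> + 2 * sqrt \<delta>) \<le> ?D"
      by (simp add: right_diff_distrib)
    have "x u \<le> 1 / ?m + \<eta>"
    proof (rule ccontr)
      assume "\<not> ?thesis"
      then have "1 - x u \<le> b" by (simp add: b_def)
      moreover have "0 \<le> 1 - x u"
        using x0 u(1) finV member_le_sum[of u V x] x1 by simp
      ultimately have pow: "(1 - x u) ^ Suc k \<le> b ^ Suc k" by (intro power_mono)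
      have k: "2 * k\<^sup>2 \<le> d" using d(1) power_mono[of k "Suc k" 2] by linarith
      have "?D \<le> clique_lagrangian d k * (1 - x u) ^ Suc k"
        using u finV x0 x1
        by (intro edge_density_le_clique_lagrangian[OF link_sparse_link[OF E u(1)] k d(2)])
          (auto simp: sum_diff1)
      also have "\<dots> \<le> clique_lagrangian d k * b ^ Suc k"
        using pow L by (intro mult_left_mono) auto
      also have "\<dots> = real (Suc (Suc k)) * ?L - \<tau>"
        unfolding \<tau>_def clique_lagrangian_Suc[OF d(2)] by (simp add: right_diff_distrib)
      finally show False using D \<delta>(4) by simp
    qed
    then show "1 / ?m - \<eta> \<le> x u \<and> x u \<le> 1 / ?m + \<eta> \<and> real (Suc (Suc k)) * ?L - \<eta> \<le> ?D"
      using low \<delta> D by auto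
  qed
qed

subsection \<open>Stability for weightings\<close>

text \<open>
  Cut the weights at height \<open>y\<close>. The part above \<open>y\<close> lives on at most \<open>d\<close> vertices, where even the
  complete graph has only \<open>(d - 1) / 2\<close> edges per vertex.
\<close>

lemma graph_sum_Min_gap:
  assumes E: "link_sparse d 2 V E" and d: "1 \<le> d" and x0: "\<And>v. v \<in> V \<Longrightarrow> 0 \<le> x v" and "0 \<le> y"
    and few: "card {v \<in> V. y \<le> x v} \<le> d" and u: "u \<in> V" "y \<le> x u"
  shows "(\<Sum>e\<in>E. Min (x ` e)) \<le> real d / 2 * (\<Sum>v\<in>V. x v) - (x u - y) / 2"
proof -
  note unif = link_sparse_uniform[OF E]
  have finV: "finite V" using unif by (simp add: uniform_def)
  have edge: "e \<subseteq> V \<and> e \<noteq> {}" if "e \<in> E" for e using unif that by (auto simp: uniform_def)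
  define B where "B = {v \<in> V. y \<le> x v}"
  have finB: "finite B" using finV by (simp add: B_def)
  \<comment> \<open>\<open>z\<close> is the part of the weight above the cut, supported on
    \<open>B\<close>; \<open>min (x v) y\<close> is the part below.\<close>
  define z where "z = (\<lambda>v. max (x v - y) 0)"
  define EB where "EB = {e \<in> E. e \<subseteq> B}"
  have "(\<Sum>e\<in>E. Min ((\<lambda>v. min (x v) y) ` e)) \<le> real d / 2 * (\<Sum>v\<in>V. min (x v) y)"
    using finV edge link_sparse_graph_edges[OF E] x0 \<open>0 \<le> y\<close> by (intro sum_Min_le) auto
  moreover have "(\<Sum>e\<in>EB. Min (z ` e)) \<le> (real d - 1) / 2 * (\<Sum>v\<in>B. z v)"
  proof (rule sum_Min_le[OF finB])
    show "e \<subseteq> B \<and> e \<noteq> {}" if "e \<in> EB" for e using that edge by (auto simp: EB_def)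
    show "0 \<le> z v" for v by (simp add: z_def)
    show "real (card {e \<in> EB. e \<subseteq> A}) \<le> (real d - 1) / 2 * real (card A)" if A: "A \<subseteq> B" for A
    proof -
      have finA: "finite A" using A finB finite_subset by blast
      have "card {e \<in> EB. e \<subseteq> A} \<le> card {e. e \<subseteq> A \<and> card e = 2}"
        using unif finA by (intro card_mono) (auto simp: EB_def uniform_def)
      also have "\<dots> = card A * (card A - 1) div 2" using n_subsets[OF finA] choose_two by simp
      finally have "2 * card {e \<in> EB. e \<subseteq> A} \<le> card A * (card A - 1)" by simp
      also have "\<dots> \<le> card A * (d - 1)"
        using few card_mono[OF finB A] by (intro mult_left_mono) (auto simp: B_def)
      finally have "real (2 * card {e \<in> EB. e \<subseteq> A}) \<le> real (card A * (d - 1))" by (rule of_nat_mono)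
      then show ?thesis using d by (simp add: of_nat_diff mult.commute)
    qed
  qed
  moreover have "(\<Sum>e\<in>E. Min (z ` e)) = (\<Sum>e\<in>EB. Min (z ` e))"
  proof (rule sum.mono_neutral_right)
    show "finite E" using unif by (rule uniform_finite)
    show "\<forall>e\<in>E - EB. Min (z ` e) = 0"
    proof
      fix e assume e: "e \<in> E - EB"
      then obtain v where "v \<in> e" "v \<notin> B" by (auto simp: EB_def)
      then have "0 \<in> z ` e" using edge[of e] e by (force simp: z_def B_def)
      moreover have "finite (z ` e)" using e uniform_finite_edge[OF unif] by auto
      ultimately show "Min (z ` e) = 0" by (intro Min_eqI) (auto simp: z_def)
    qed
  qed (auto simp: EB_def)
  moreover have "Min (x ` e) = Min ((\<lambda>v. min (x v) y) ` e) + Min (z ` e)" if "e \<in> E" for e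
  proof -
    have "card e = 2" using unif that by (simp add: uniform_def)
    then obtain a b where ab: "e = {a, b}" by (auto simp: card_2_iff)
    \<comment> \<open>Both parts are increasing functions of the weight, so both minima are attained
      at the lighter endpoint.\<close>
    have "min (x a) (x b) = min (min (x a) y) (min (x b) y) + min (z a) (z b)"
      by (auto simp: z_def min_def max_def)
    then show ?thesis unfolding ab by simp
  qed
  then have "(\<Sum>e\<in>E. Min (x ` e)) = (\<Sum>e\<in>E. Min ((\<lambda>v. min (x v) y) ` e)) + (\<Sum>e\<in>E. Min (z ` e))"
    by (simp add: sum.distrib)
  moreover have "(\<Sum>v\<in>V. x v) = (\<Sum>v\<in>V. min (x v) y) + (\<Sum>v\<in>B. z v)"
  proof -
    have "(\<Sum>v\<in>B. z v) = (\<Sum>v\<in>V. z v)"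
      using finV by (intro sum.mono_neutral_left) (auto simp: B_def z_def)
    moreover have "(\<Sum>v\<in>V. x v) = (\<Sum>v\<in>V. min (x v) y + z v)"
      by (intro sum.cong) (auto simp: z_def)
    ultimately show ?thesis by (simp add: sum.distrib)
  qed
  moreover have "x u - y \<le> (\<Sum>v\<in>B. z v)"
  proof -
    have "z u \<le> (\<Sum>v\<in>B. z v)" using finB u by (intro member_le_sum) (auto simp: B_def z_def)
    then show ?thesis using u by (simp add: z_def)
  qed
  ultimately show ?thesis by (simp add: field_simps)
qed

text \<open>Lower bounds on \<open>d + Suc k\<close> vertices determine the weighting up to small
  error, since they leave little weight for all others. In the induction step the heaviest vertex is
  added to the vertices found in its link, whose weighting is first rescaled to total 1.\<close>

lemma weighted_sparse_stability:
  assumes "2 * (Suc k)\<^sup>2 \<le> d" and "0 < d" and "0 < \<eta>"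
  shows "\<exists>\<delta>>0. \<forall>V E (x :: 'a \<Rightarrow> real). weighted_sparse d (Suc k) V E x \<and>
      clique_lagrangian d (Suc k) - \<delta> \<le> edge_density E x \<longrightarrow>
      (\<exists>S\<subseteq>V. card S = d + Suc k \<and> (\<forall>v\<in>S. 1 / real (d + Suc k) - \<eta> \<le> x v))"
  using assms
proof (induction k arbitrary: \<eta>)
  case 0
  let ?m = "real (d + Suc 0)"
  \<comment> \<open>The bound \<open>1 / ?m\<close> keeps the cut height \<open>y\<close> below
    nonnegative. Too few vertices above the cut save \<open>\<eta>' / (4 * ?m)\<close> in density.
    Half of this saving absorbs the error \<kappa> in the heaviest weight, and a quarter absorbs
    \<open>\<delta>'\<close>.\<close>
  define \<eta>' where "\<eta>' = min \<eta> (1 / ?m)"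
  define \<kappa> where "\<kappa> = min (\<eta>' / 2) (\<eta>' / (4 * ?m * real d))"
  have \<eta>': "0 < \<eta>'" "\<eta>' \<le> \<eta>" "\<eta>' \<le> 1 / ?m" using 0 by (auto simp: \<eta>'_def)
  have \<kappa>: "0 < \<kappa>" "\<kappa> \<le> \<eta>' / 2" "\<kappa> \<le> \<eta>' / (4 * ?m * real d)"
  proof -
    have "0 < \<eta>' / (4 * ?m * real d)" using \<eta>' 0(2) by (intro divide_pos_pos mult_pos_pos) auto
    then show "0 < \<kappa>" "\<kappa> \<le> \<eta>' / 2" "\<kappa> \<le> \<eta>' / (4 * ?m * real d)"
      using \<eta>'(1) unfolding \<kappa>_def by (simp_all only: min.cobounded1 min.cobounded2 min_less_iff_conj half_gt_zero)
  qed
  obtain \<delta> where \<delta>: "0 < \<delta>"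
    "\<And>V E (x :: 'a \<Rightarrow> real) u. \<lbrakk>weighted_sparse d (Suc 0) V E x; u \<in> V; \<And>v. v \<in> V \<Longrightarrow> x v \<le> x u;
        clique_lagrangian d (Suc 0) - \<delta> \<le> edge_density E x\<rbrakk> \<Longrightarrow>
      1 / ?m - \<kappa> \<le> x u \<and> x u \<le> 1 / ?m + \<kappa> \<and>
      real (Suc (Suc 0)) * clique_lagrangian d (Suc 0) - \<kappa> \<le> edge_density (link_edges E u) x"
    using weighted_sparse_near_optimal[OF 0(1,2) \<kappa>(1)] by metis
  define \<delta>' where "\<delta>' = min \<delta> (\<eta>' / (16 * ?m))"
  have "0 < \<delta>'" using \<delta>(1) \<eta>' by (simp add: \<delta>'_def)
  moreover have "\<exists>S\<subseteq>V. card S = d + Suc 0 \<and> (\<forall>v\<in>S. 1 / ?m - \<eta> \<le> x v)"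
    if W: "weighted_sparse d (Suc 0) V E x" and p: "clique_lagrangian d (Suc 0) - \<delta>' \<le> edge_density E x"
    for V E and x :: "'a \<Rightarrow> real"
  proof (rule ccontr)
    assume contra: "\<not> ?thesis"
    have E: "link_sparse d 2 V E" and x0: "\<And>v. v \<in> V \<Longrightarrow> 0 \<le> x v"
      and x1: "(\<Sum>v\<in>V. x v) = 1" using W by (auto simp: weighted_sparse_def numeral_2_eq_2)
    note unif = link_sparse_uniform[OF E]
    have finV: "finite V" using unif by (simp add: uniform_def)
    have "V \<noteq> {}" using x1 by auto
    have "Max (x ` V) \<in> x ` V" using finV \<open>V \<noteq> {}\<close> by (intro Max_in) auto
    then obtain u where "u \<in> V" "x u = Max (x ` V)" by auto
    then have u: "u \<in> V" "\<And>v. v \<in> V \<Longrightarrow> x v \<le> x u" using finV by auto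
    define y where "y = 1 / ?m - \<eta>'"
    define B where "B = {v \<in> V. y \<le> x v}"
    have "card B \<le> d"
    proof (rule ccontr)
      assume "\<not> ?thesis"
      then obtain S where "S \<subseteq> B" "card S = d + Suc 0"
        using obtain_subset_with_card_n[of "d + Suc 0" B] by auto
      then show False using contra \<eta>'(2) unfolding B_def y_def by fastforce
    qed
    have xu: "1 / ?m - \<kappa> \<le> x u" "x u \<le> 1 / ?m + \<kappa>"
      using \<delta>(2)[OF W u] p by (auto simp: \<delta>'_def)
    have gap: "\<eta>' / 2 \<le> x u - y" using xu \<kappa> by (simp add: y_def)
    have gap': "(\<Sum>e\<in>E. Min (x ` e)) \<le> real d / 2 * (\<Sum>v\<in>V. x v) - (x u - y) / 2"
      using \<open>card B \<le> d\<close> gap \<eta>' 0(2) x0 u(1)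
      by (intro graph_sum_Min_gap[OF E]) (auto simp: B_def y_def)
    have le: "(\<Sum>e\<in>E. Min (x ` e)) \<le> real d / 2 - \<eta>' / 4"
    proof -
      have "S \<le> D - e / 4" if "S \<le> D * 1 - (p - q) / 2" "e / 2 \<le> p - q" for S D e p q :: real
        using that by (simp add: field_simps)
      then show ?thesis using gap' gap unfolding x1 by blast
    qed
    have "edge_density E x \<le> x u * (\<Sum>e\<in>E. Min (x ` e))"
      using graph_edge_density_le_sum_Min[OF unif] x0 u by blast
    also have "\<dots> \<le> x u * (real d / 2 - \<eta>' / 4)" using le x0[OF u(1)] by (rule mult_left_mono)
    also have "\<dots> \<le> (1 / ?m + \<kappa>) * (real d / 2 - \<eta>' / 4)"
    proof (rule mult_right_mono[OF xu(2)])
      have "1 / ?m \<le> 1" by simp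
      then have "\<eta>' \<le> 1" using \<eta>'(3) by (rule order_trans[rotated])
      moreover have "1 \<le> real d" using 0(2) by simp
      ultimately show "0 \<le> real d / 2 - \<eta>' / 4" by linarith
    qed
    also have "\<dots> \<le> real d / 2 * (1 / ?m) + \<kappa> * real d / 2 - \<eta>' / (4 * ?m)"
      using \<kappa>(1) \<eta>'(1) by (simp add: algebra_simps del: of_nat_add)
    also have "\<kappa> * real d / 2 \<le> \<eta>' / (4 * ?m * real d) * real d / 2"
      using \<kappa>(3) by (intro divide_right_mono mult_right_mono) auto
    also have "\<dots> = \<eta>' / (8 * ?m)" using 0(2) by simp
    finally have "edge_density E x \<le> real d / 2 * (1 / ?m) + \<eta>' / (8 * ?m) - \<eta>' / (4 * ?m)" by simp
    moreover have "clique_lagrangian d (Suc 0) = real d / 2 * (1 / ?m)"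
      by (simp add: clique_lagrangian_def cap_poly_def)
    moreover have "\<delta>' \<le> \<eta>' / (16 * ?m)" by (simp add: \<delta>'_def)
    moreover have "\<eta>' / (16 * ?m) + \<eta>' / (8 * ?m) < \<eta>' / (4 * ?m)"
    proof -
      have "e / (16 * m) + e / (8 * m) < e / (4 * m)" if "0 < e" "0 < m" for e m :: real
        using that by (simp add: field_simps)
      moreover have "0 < ?m" by simp
      ultimately show ?thesis using \<eta>'(1) by blast
    qed
    ultimately show False using p by linarith
  qed
  ultimately show ?case by blast
next
  case (Suc k)
  let ?n = "real (d + Suc k)" and ?m = "real (d + Suc (Suc k))"
  let ?L = "clique_lagrangian d (Suc k)" and ?r = "Suc (Suc k)"
  define A where "A = 1 - 1 / ?m"
  have A: "0 < A" "A / ?n = 1 / ?m"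
  proof -
    have "?m = ?n + 1" by simp
    moreover have "0 < ?n" using Suc.prems by simp
    moreover have "0 < 1 - 1 / (n + 1) \<and> (1 - 1 / (n + 1)) / n = 1 / (n + 1)" if "0 < n" for n :: real
    proof -
      have "1 - 1 / (n + 1) = n / (n + 1)" using that by (simp add: field_simps)
      then show ?thesis using that by simp
    qed
    ultimately show "0 < A" "A / ?n = 1 / ?m" unfolding A_def by metis+
  qed
  have L: "0 < ?L" using clique_lagrangian_pos Suc.prems by blast
  have k: "2 * (Suc k)\<^sup>2 \<le> d"
    using Suc.prems(1) power_mono[of "Suc k" "Suc (Suc k)" 2] by linarith
  obtain \<delta>1 where \<delta>1: "0 < \<delta>1"
    "\<And>V E (x :: 'a \<Rightarrow> real). \<lbrakk>weighted_sparse d (Suc k) V E x; ?L - \<delta>1 \<le> edge_density E x\<rbrakk> \<Longrightarrow>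
      \<exists>S\<subseteq>V. card S = d + Suc k \<and> (\<forall>v\<in>S. 1 / ?n - \<eta> / 2 \<le> x v)"
    using Suc.IH[OF k Suc.prems(2), of "\<eta> / 2"] Suc.prems(3) by (auto simp del: of_nat_add)
  \<comment> \<open>The bound \<open>?L / 2\<close> keeps \<open>?L - \<delta>2\<close> positive, so
    the link density is positive and some weight is left to rescale.\<close>
  define \<delta>2 where "\<delta>2 = min \<delta>1 (?L / 2)"
  have \<delta>2: "0 < \<delta>2" "\<delta>2 \<le> \<delta>1" "0 < ?L - \<delta>2" using \<delta>1 L by (auto simp: \<delta>2_def)
  \<comment> \<open>The ideal link density is \<open>?L * A ^ ?r\<close>. For small \<kappa>, a link
    density within \<kappa> of it, divided by the power of a total weight up to
    \<open>A + \<kappa>\<close>, stays at least \<open>?L - \<delta>2\<close>.\<close>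
  have "((\<lambda>\<kappa>. (?L - \<delta>2) * (A + \<kappa>) ^ ?r + \<kappa>) \<longlongrightarrow> (?L - \<delta>2) * (A + 0) ^ ?r + 0) (at_right 0)"
    by (intro tendsto_intros)
  moreover have "(?L - \<delta>2) * (A + 0) ^ ?r + 0 < ?L * A ^ ?r"
    using \<delta>2 A(1) by simp
  ultimately have "eventually (\<lambda>\<kappa>. (?L - \<delta>2) * (A + \<kappa>) ^ ?r + \<kappa> < ?L * A ^ ?r) (at_right 0)"
    by (rule order_tendstoD)
  moreover have "eventually (\<lambda>\<kappa>. \<kappa> < \<eta> / 2) (at_right 0)"
    using Suc.prems(3) by (intro order_tendstoD[OF tendsto_ident_at]) auto
  moreover have "eventually (\<lambda>\<kappa>::real. 0 < \<kappa>) (at_right 0)" by (rule eventually_at_right_less)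
  ultimately have "eventually (\<lambda>\<kappa>. 0 < \<kappa> \<and> \<kappa> < \<eta> / 2 \<and>
      (?L - \<delta>2) * (A + \<kappa>) ^ ?r + \<kappa> < ?L * A ^ ?r) (at_right 0)"
    by eventually_elim blast
  then obtain \<kappa> where \<kappa>: "0 < \<kappa>" "\<kappa> < \<eta> / 2" "(?L - \<delta>2) * (A + \<kappa>) ^ ?r + \<kappa> < ?L * A ^ ?r"
    using eventually_happens'[OF trivial_limit_at_right_real] by blast
  obtain \<delta> where \<delta>: "0 < \<delta>"
    "\<And>V E (x :: 'a \<Rightarrow> real) u. \<lbrakk>weighted_sparse d ?r V E x; u \<in> V; \<And>v. v \<in> V \<Longrightarrow> x v \<le> x u;
        clique_lagrangian d ?r - \<delta> \<le> edge_density E x\<rbrakk> \<Longrightarrow>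
      1 / ?m - \<kappa> \<le> x u \<and> x u \<le> 1 / ?m + \<kappa> \<and>
      real (Suc ?r) * clique_lagrangian d ?r - \<kappa> \<le> edge_density (link_edges E u) x"
    using weighted_sparse_near_optimal[OF Suc.prems(1,2) \<kappa>(1)] by metis
  have "\<exists>S\<subseteq>V. card S = d + ?r \<and> (\<forall>v\<in>S. 1 / ?m - \<eta> \<le> x v)"
    if W: "weighted_sparse d ?r V E x" and p: "clique_lagrangian d ?r - \<delta> \<le> edge_density E x"
    for V E and x :: "'a \<Rightarrow> real"
  proof -
    have E: "link_sparse d (Suc ?r) V E" and x0: "\<And>v. v \<in> V \<Longrightarrow> 0 \<le> x v"
      and x1: "(\<Sum>v\<in>V. x v) = 1" using W by (auto simp: weighted_sparse_def)
    have finV: "finite V" using link_sparse_uniform[OF E] by (simp add: uniform_def)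
    have "V \<noteq> {}" using x1 by auto
    have "Max (x ` V) \<in> x ` V" using finV \<open>V \<noteq> {}\<close> by (intro Max_in) auto
    then obtain u where "u \<in> V" "x u = Max (x ` V)" by auto
    then have u: "u \<in> V" "\<And>v. v \<in> V \<Longrightarrow> x v \<le> x u" using finV by auto
    let ?D = "edge_density (link_edges E u) x"
    note xu = \<delta>(2)[OF W u p]
    note Eu = link_sparse_link[OF E u(1)]
    define b where "b = 1 - x u"
    have sum_b: "(\<Sum>v\<in>V - {u}. x v) = b" using x1 u finV by (simp add: sum_diff1 b_def)
    have "0 \<le> b" using x0 unfolding sum_b[symmetric] by (intro sum_nonneg) auto
    have D: "(?L - \<delta>2) * (A + \<kappa>) ^ ?r \<le> ?D"
      using xu \<kappa>(3) clique_lagrangian_Suc[OF Suc.prems(2), of "Suc k"] unfolding A_def by linarith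
    have "0 < ?D"
    proof -
      have "0 < (?L - \<delta>2) * (A + \<kappa>) ^ ?r" using \<delta>2 A \<kappa> by simp
      then show ?thesis using D by linarith
    qed
    moreover have "?D \<le> ?L * b ^ ?r"
      using x0 sum_b by (intro edge_density_le_clique_lagrangian[OF Eu k Suc.prems(2)]) auto
    ultimately have "b \<noteq> 0" by auto
    then have b: "0 < b" using \<open>0 \<le> b\<close> by simp
    have bA: "A - \<kappa> \<le> b" "b \<le> A + \<kappa>" using xu by (auto simp: b_def A_def)
    define z where "z = (\<lambda>v. 1 / b * x v)"
    have "weighted_sparse d (Suc k) (V - {u}) (link_edges E u) z"
      using Eu x0 b sum_b by (auto simp: weighted_sparse_def z_def sum_distrib_left[symmetric] sum_divide_distrib[symmetric])
    moreover have "?L - \<delta>1 \<le> edge_density (link_edges E u) z"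
    proof -
      have "(?L - \<delta>2) * b ^ ?r \<le> (?L - \<delta>2) * (A + \<kappa>) ^ ?r"
        using \<delta>2 b bA by (intro mult_left_mono power_mono) auto
      then have "(?L - \<delta>2) * b ^ ?r \<le> ?D" using D by linarith
      then have "?L - \<delta>2 \<le> ?D / b ^ ?r" using b by (simp only: pos_le_divide_eq zero_less_power)
      moreover have "edge_density (link_edges E u) z = ?D / b ^ ?r"
        unfolding z_def edge_density_scale[OF link_sparse_uniform[OF Eu]]
        by (simp only: power_one_over times_divide_eq_left mult_1_left)
      ultimately show ?thesis using \<delta>2 by linarith
    qed
    ultimately obtain S where S: "S \<subseteq> V - {u}" "card S = d + Suc k" "\<And>v. v \<in> S \<Longrightarrow> 1 / ?n - \<eta> / 2 \<le> z v"
      using \<delta>1(2) by meson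
    have "finite S" "u \<notin> S" using S(1) finV finite_subset by blast+
    then have "card (insert u S) = d + ?r" using S(2) by simp
    moreover have "1 / ?m - \<eta> \<le> x v" if v: "v \<in> S" for v
    proof -
      \<comment> \<open>Undoing the rescaling: half of \<eta> is lost through the induction
        hypothesis, less than the other half through the deviation of \<open>b\<close> from
        \<open>A\<close>.\<close>
      have "b * (1 / ?n - \<eta> / 2) \<le> b * z v" using S(3)[OF v] b by (intro mult_left_mono) auto
      also have "\<dots> = x v" using b by (simp add: z_def)
      finally have "b / ?n - b * (\<eta> / 2) \<le> x v" by (simp add: right_diff_distrib)
      moreover have "b * (\<eta> / 2) \<le> 1 * (\<eta> / 2)"
        using x0[OF u(1)] Suc.prems(3) by (intro mult_right_mono) (auto simp: b_def)
      moreover have "(A - \<kappa>) / ?n \<le> b / ?n" using bA by (intro divide_right_mono) auto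
      moreover have "(A - \<kappa>) / ?n = 1 / ?m - \<kappa> / ?n" using A(2) by (simp only: diff_divide_distrib)
      moreover have "\<kappa> / ?n \<le> \<kappa> / 1" using \<kappa>(1) Suc.prems(2) by (intro divide_left_mono) auto
      ultimately show ?thesis using \<kappa>(2) by linarith
    qed
    moreover have "1 / ?m - \<eta> \<le> x u" using xu \<kappa>(1,2) by linarith
    ultimately show ?thesis using S(1) u(1) by (intro exI[of _ "insert u S"]) auto
  qed
  then show ?case using \<delta>(1) by blast
qed

subsection \<open>Expansions, blowups and distances\<close>

lemma rgraph_uniform: "rgraph r F \<Longrightarrow> uniform r (verts F) (edges F)"
  by (simp add: rgraph_def uniform_def)

text \<open>With all weights equal to 1, Euler's identity is the handshake count.\<close>

lemma average_degree_eq: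
  assumes "rgraph r G"
  shows "average_degree G = real r * real (card (edges G)) / real (card (verts G))"
  using sum_edge_density_link[OF rgraph_uniform[OF assms], of "\<lambda>_. 1"]
    edge_density_link[OF rgraph_uniform[OF assms], of "\<lambda>_. 1"]
  by (simp add: average_degree_def vertex_degree_def edge_density_def)

text \<open>If the link graph of \<open>I\<close> had more edges on \<open>A\<close>, its average
  degree would exceed \<open>t - 2\<close> and it would contain \<open>T\<close>. Mapping the new
  vertices of the expansion onto \<open>I\<close> completes a forbidden copy.\<close>

lemma Forb_link_sparse:
  fixes T F :: "nat hypergraph"
  assumes T: "erdos_sos_tree T" "card (verts T) = t" "2 \<le> t"
    and F: "F \<in> Forb r (expansion (r - 2) T)"
  shows "link_sparse (t - 2) r (verts F) (edges F)"
  unfolding link_sparse_def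
proof (intro conjI allI impI)
  have rF: "rgraph r F" and no_copy: "\<not> contains_copy F (expansion (r - 2) T)"
    using F by (auto simp: Forb_def)
  show "uniform r (verts F) (edges F)" using rF by (rule rgraph_uniform)
  fix I A assume IA: "I \<subseteq> verts F" "A \<subseteq> verts F" "I \<inter> A = {}" "card I + 2 = r"
  define EA where "EA = {e. e \<subseteq> A \<and> card e = 2 \<and> I \<union> e \<in> edges F}"
  have fin: "finite I" "finite A" using IA rF by (meson finite_subset rgraph_def)+
  show "2 * card {e. e \<subseteq> A \<and> card e = 2 \<and> I \<union> e \<in> edges F} \<le> (t - 2) * card A"
  proof (rule ccontr)
    assume "\<not> ?thesis"
    then have many: "(t - 2) * card A < 2 * card EA" by (simp add: EA_def)
    have "A \<noteq> {}"
    proof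
      assume "A = {}"
      then have "EA = {}" by (auto simp: EA_def)
      then show False using many by simp
    qed
    then have rG: "rgraph 2 (Hypergraph A EA)" using fin by (auto simp: rgraph_def EA_def)
    have "real ((t - 2) * card A) < real (2 * card EA)" using many by (simp only: of_nat_less_iff)
    then have "average_degree (Hypergraph A EA) > real (card (verts T)) - 2"
      using T(2,3) \<open>A \<noteq> {}\<close> fin unfolding average_degree_eq[OF rG]
      by (simp add: of_nat_diff pos_less_divide_eq card_gt_0_iff)
    then have "contains_copy (Hypergraph A EA) T"
      using T(1) rG by (auto simp: erdos_sos_tree_def)
    then obtain f where f: "inj_on f (verts T)" "f ` verts T \<subseteq> A" "\<And>e. e \<in> edges T \<Longrightarrow> f ` e \<in> EA"
      by (auto simp: contains_copy_def)
    obtain g where g: "bij_betw g {..<r - 2} I"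
      using ex_bij_betw_nat_finite[OF fin(1)] IA(4) by (auto simp: lessThan_atLeast0)
    have g': "g ` {..<r - 2} = I" "inj_on g {..<r - 2}" using g by (auto simp: bij_betw_def)
    define h where "h = case_sum f g"
    have img: "h ` (Inl ` X \<union> Inr ` {..<r - 2}) = f ` X \<union> I" for X
      using g' by (auto simp: h_def image_Un image_image)
    have "contains_copy F (expansion (r - 2) T)"
      unfolding contains_copy_def expansion_def hypergraph.sel
    proof (intro exI[of _ h] conjI ballI)
      have "f x \<noteq> g i" if "x \<in> verts T" "i < r - 2" for x i
        using that f(2) g' IA(3) by blast
      then show "inj_on h (Inl ` verts T \<union> Inr ` {..<r - 2})"
        using f(1) g'(2) by (force simp: inj_on_def h_def)
      show "h ` (Inl ` verts T \<union> Inr ` {..<r - 2}) \<subseteq> verts F"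
        unfolding img using f(2) IA by auto
      fix e assume "e \<in> {Inl ` e \<union> Inr ` {..<r - 2} |e. e \<in> edges T}"
      then obtain e' where e': "e = Inl ` e' \<union> Inr ` {..<r - 2}" "e' \<in> edges T" by auto
      have "I \<union> f ` e' \<in> edges F" using f(3)[OF e'(2)] by (simp add: EA_def)
      then show "h ` e \<in> edges F" unfolding e' img by (simp add: Un_commute)
    qed
    then show False using no_copy by blast
  qed
qed

text \<open>The set \<open>I\<close> takes \<open>k - 1\<close> of the \<open>d + k\<close>
  vertices, so at most \<open>d + 1\<close> remain for \<open>A\<close>, and each is adjacent to at
  most \<open>d\<close> others. Hence the clique itself obeys the Lagrangian bound, which the final
  distance estimate uses.\<close>

lemma complete_link_sparse:
  assumes "finite S" and "card S = d + k"
  shows "link_sparse d (Suc k) S {e. e \<subseteq> S \<and> card e = Suc k}"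
  unfolding link_sparse_def
proof (intro conjI allI impI)
  show "uniform (Suc k) S {e. e \<subseteq> S \<and> card e = Suc k}" using assms by (simp add: uniform_def)
  fix I A assume IA: "I \<subseteq> S" "A \<subseteq> S" "I \<inter> A = {}" "card I + 2 = Suc k"
  have fin: "finite I" "finite A" using IA assms finite_subset by auto
  have "card I + card A \<le> card S"
    using IA fin assms by (metis card_Un_disjoint card_mono Un_least)
  then have A: "card A - 1 \<le> d" using IA(4) assms(2) by linarith
  have "card {e. e \<subseteq> A \<and> card e = 2 \<and> I \<union> e \<in> {e. e \<subseteq> S \<and> card e = Suc k}}
      \<le> card {e. e \<subseteq> A \<and> card e = 2}"
    using fin by (intro card_mono) auto
  also have "\<dots> = card A * (card A - 1) div 2" using n_subsets[OF fin(2)] choose_two by simp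
  finally have "2 * card {e. e \<subseteq> A \<and> card e = 2 \<and> I \<union> e \<in> {e. e \<subseteq> S \<and> card e = Suc k}}
      \<le> card A * (card A - 1)" by simp
  also have "\<dots> \<le> d * card A" using A by (simp add: mult.commute)
  finally show "2 * card {e. e \<subseteq> A \<and> card e = 2 \<and> I \<union> e \<in> {e. e \<subseteq> S \<and> card e = Suc k}}
      \<le> d * card A" .
qed

section \<open>Blowups remain uniform hypergraphs\<close>

lemma clone_rgraph:
  assumes F: "rgraph r F" and "clone F v W G"
  shows "rgraph r G"
proof -
  have c: "v \<in> verts F" "v \<in> W" "finite W" "verts F \<subseteq> verts G" "edges F \<subseteq> edges G"
    "verts G - verts F = W - {v}" "\<And>w. w \<in> W \<Longrightarrow> link G w = link F v"
    "\<And>e. e \<in> edges G - edges F \<Longrightarrow> e \<inter> W \<noteq> {}"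
    using assms(2) by (auto simp: clone_def)
  have VG: "verts G = verts F \<union> W" using c(1,4,6) by blast
  have "e \<subseteq> verts G \<and> card e = r" if "e \<in> edges G" for e
  proof (cases "e \<in> edges F")
    case True
    then show ?thesis using F VG by (auto simp: rgraph_def)
  next
    case False
    then obtain w where w: "w \<in> e" "w \<in> W" using c(8)[of e] \<open>e \<in> edges G\<close> by blast
    \<comment> \<open>Exchanging the clone \<open>w\<close> for \<open>v\<close> turns a new edge
      into an edge of \<open>F\<close> of the same size.\<close>
    then have "e - {w} \<in> link G w" using that by (simp add: link_def insert_absorb)
    then have "e - {w} \<in> link F v" unfolding c(7)[OF w(2)] .
    then have I: "v \<notin> e - {w}" "insert v (e - {w}) \<in> edges F"
      unfolding link_def mem_Collect_eq by blast+
    then have sub: "insert v (e - {w}) \<subseteq> verts F" "card (insert v (e - {w})) = r"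
      using F by (auto simp: rgraph_def)
    have fin: "finite (e - {w})"
      using sub(1) F finite_subset[of "e - {w}" "verts F"] by (auto simp: rgraph_def)
    have "card (insert w (e - {w})) = Suc (card (e - {w}))" using fin by (rule card_insert_disjoint) simp
    moreover have "insert w (e - {w}) = e" using w(1) by blast
    ultimately have "card e = r" using sub(2) card_insert_disjoint[OF fin I(1)] by simp
    then show ?thesis using sub(1) VG w by auto
  qed
  then show ?thesis using F c(3) VG by (auto simp: rgraph_def)
qed

lemma hg_iso_rgraph:
  assumes "rgraph r F" and "hg_iso f F G"
  shows "rgraph r G"
proof -
  have f: "inj_on f (verts F)" "f ` verts F = verts G" "edges G = (`) f ` edges F"
    using assms(2) by (auto simp: hg_iso_def bij_betw_def)
  have "f ` e \<subseteq> verts G \<and> card (f ` e) = r" if "e \<in> edges F" for e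
    using that assms(1) f(1,2) by (auto simp: rgraph_def card_image inj_on_subset)
  moreover have "finite (verts G)" "verts G \<noteq> {}"
    using assms(1) unfolding f(2)[symmetric] by (auto simp: rgraph_def)
  ultimately show ?thesis using f(3) by (auto simp: rgraph_def)
qed

lemma blowups_rgraph:
  assumes "rgraph r F" and "H \<in> blowups F"
  shows "rgraph r H"
proof -
  obtain G f where G: "clone_delete_step\<^sup>*\<^sup>* F G" "hg_iso f G H"
    using assms(2) by (auto simp: blowups_def)
  have "rgraph r G" using G(1)
  proof (induction rule: rtranclp_induct)
    case (step G G')
    from step(2,3) show ?case
    proof (cases rule: clone_delete_step.cases)
      case (cloning v W)
      then show ?thesis using clone_rgraph step(3) by metis
    next
      case (deleting v)
      then show ?thesis using step(3) by (auto simp: rgraph_def delete_vertex_def)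
    qed
  qed (rule assms(1))
  then show ?thesis using hg_iso_rgraph G(2) by blast
qed

lemma hg_iso_id: "hg_iso id F F"
  by (simp add: hg_iso_def)

lemma weighted_blowups_wf:
  assumes "rgraph r F" and "\<mu> \<in> distributions F" and "(F', \<mu>') \<in> weighted_blowups (F, \<mu>)"
  shows "rgraph r F' \<and> (\<forall>v\<in>verts F'. 0 \<le> \<mu>' v)"
proof -
  obtain Y where Y: "one_vertex_blowup\<^sup>*\<^sup>* (F, \<mu>) Y" "weighted_iso Y (F', \<mu>')"
    using assms(3) by (auto simp: weighted_blowups_def)
  from Y(1) have "rgraph r (fst Y) \<and> snd Y \<in> distributions (fst Y)"
  proof (induction rule: rtranclp_induct)
    case base
    then show ?case using assms by simp
  next
    case (step Y Z)
    obtain G \<nu> G' \<nu>' where "Y = (G, \<nu>)" "Z = (G', \<nu>')" by (cases Y, cases Z)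
    moreover from this step(2) obtain u W where "clone G u W G'" "\<nu>' \<in> distributions G'"
      by (auto simp: one_vertex_blowup_def)
    ultimately show ?case using clone_rgraph[of r G u W G'] step(3) by simp
  qed
  then have wf: "rgraph r (fst Y)" "\<And>v. v \<in> verts (fst Y) \<Longrightarrow> 0 \<le> snd Y v"
    by (auto simp: distributions_def)
  obtain f where f: "hg_iso f (fst Y) F'" "\<And>v. v \<in> verts (fst Y) \<Longrightarrow> \<mu>' (f v) = snd Y v"
    using Y(2) by (auto simp: weighted_iso_def split: prod.splits)
  have "verts F' = f ` verts (fst Y)" using f(1) by (auto simp: hg_iso_def bij_betw_def)
  then show ?thesis using hg_iso_rgraph[OF wf(1) f(1)] f(2) wf(2) by auto
qed

lemma weighted_blowups_refl: "X \<in> weighted_blowups X"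
proof -
  have "weighted_iso X X"
    unfolding weighted_iso_def using hg_iso_id[of "fst X"] by (force split: prod.splits)
  then show ?thesis unfolding weighted_blowups_def by blast
qed

section \<open>Bounding the distance to a family\<close>

lemma dist_common_nonneg:
  assumes "rgraph r F1" "rgraph r F2" "verts F1 = verts F2" "\<forall>v\<in>verts F1. 0 \<le> \<mu> v"
  shows "0 \<le> dist_common F1 F2 \<mu>"
  unfolding dist_common_def
proof (intro sum_nonneg prod_nonneg)
  fix e v assume "e \<in> sym_diff (edges F1) (edges F2)" "v \<in> e"
  then have "v \<in> verts F1" using assms(1-3) unfolding rgraph_def by blast
  then show "0 \<le> \<mu> v" using assms(4) by blast
qed

text \<open>On a common vertex set the two hypergraphs with the same weights are admissible in both
  infima without any weighted blowup. The remaining work is to show that these infima are taken over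
  sets bounded below.\<close>

lemma dist_to_family_le_dist_common:
  assumes F: "rgraph r F" "\<mu> \<in> distributions F" and HH: "\<And>H. H \<in> \<HH> \<Longrightarrow> rgraph r H"
    and H: "H \<in> \<HH>" "verts H = verts F"
  shows "dist_to_family \<HH> (F, \<mu>) \<le> dist_common F H \<mu>"
proof -
  let ?C = "\<lambda>X Y. {dist_common F1 F2 \<mu> | F1 F2 \<mu>.
     verts F1 = verts F2 \<and> (F1, \<mu>) \<in> weighted_blowups X \<and> (F2, \<mu>) \<in> weighted_blowups Y}"
  have C_nonneg: "0 \<le> c" if "H' \<in> \<HH>" "\<mu>' \<in> distributions H'" "c \<in> ?C (F, \<mu>) (H', \<mu>')" for c H' \<mu>'
    using that dist_common_nonneg weighted_blowups_wf[OF F] weighted_blowups_wf[OF HH[OF that(1)] that(2)]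
    by blast
  text \<open>The infimum of the empty set of reals is an unspecified number.\<close>
  have lower: "min 0 (Inf {}) \<le> weighted_dist (F, \<mu>) (H', \<mu>')"
    if "H' \<in> \<HH>" "\<mu>' \<in> distributions H'" for H' \<mu>'
  proof (cases "?C (F, \<mu>) (H', \<mu>') = {}")
    case True
    show ?thesis unfolding weighted_dist_def True by simp
  next
    case False
    then have "0 \<le> weighted_dist (F, \<mu>) (H', \<mu>')"
      unfolding weighted_dist_def using C_nonneg[OF that] by (rule cInf_greatest)
    then show ?thesis by simp
  qed
  have \<mu>H: "\<mu> \<in> distributions H" using F(2) H(2) by (simp add: distributions_def)
  have "dist_to_family \<HH> (F, \<mu>) \<le> weighted_dist (F, \<mu>) (H, \<mu>)"
    unfolding dist_to_family_def
  proof (rule cInf_lower)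
    show "bdd_below {weighted_dist (F, \<mu>) (F', \<mu>') |F' \<mu>'. F' \<in> \<HH> \<and> \<mu>' \<in> distributions F'}"
      using lower by (intro bdd_belowI[of _ "min 0 (Inf {})"]) blast
  qed (use H \<mu>H in blast)
  also have "\<dots> \<le> dist_common F H \<mu>"
    unfolding weighted_dist_def
  proof (rule cInf_lower)
    show "dist_common F H \<mu> \<in> ?C (F, \<mu>) (H, \<mu>)"
      using H(2) weighted_blowups_refl by force
    show "bdd_below (?C (F, \<mu>) (H, \<mu>))"
      using C_nonneg[OF H(1) \<mu>H] by (intro bdd_belowI[of _ 0]) blast
  qed
  finally show ?thesis .
qed

section \<open>Lagrangians of cliques and their blowups\<close>

lemma hg_density_le_1:
  assumes "rgraph r F" and "\<mu> \<in> distributions F"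
  shows "hg_density F \<mu> \<le> 1"
  using edge_density_le_power[OF rgraph_uniform[OF assms(1)], of \<mu>] assms(2)
  by (simp add: distributions_def hg_density_def edge_density_def)

lemma hg_density_le_lagrangian:
  assumes "rgraph r F" and "\<mu> \<in> distributions F"
  shows "hg_density F \<mu> \<le> lagrangian F"
  unfolding lagrangian_def using hg_density_le_1[OF assms(1)] assms(2)
  by (intro cSUP_upper bdd_aboveI[of _ 1]) auto

lemma uniform_distribution:
  assumes "rgraph r F"
  shows "(\<lambda>_. 1 / real (card (verts F))) \<in> distributions F"
  using assms by (auto simp: distributions_def rgraph_def)

lemma lagrangian_le_1: "rgraph r F \<Longrightarrow> lagrangian F \<le> 1"
  unfolding lagrangian_def
proof (rule cSUP_least)
  show "distributions F \<noteq> {}" if "rgraph r F" using uniform_distribution[OF that] by blast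
qed (rule hg_density_le_1)

lemma complete_rgraph_rgraph: "0 < p \<Longrightarrow> rgraph r (complete_rgraph r p)"
  by (auto simp: rgraph_def complete_rgraph_def)

lemma clique_lagrangian_eq:
  assumes "0 < d"
  shows "clique_lagrangian d k =
    real ((d + k) choose Suc k) * (1 / real (d + k)) ^ Suc k"
proof -
  let ?m = "real (d + k)"
  have m: "0 < ?m" using assms by simp
  have "(\<Prod>i<k. 1 - real i * (1 / ?m)) = (\<Prod>i<k. (1 / ?m) * (?m - real i))"
    using m by (intro prod.cong) (simp_all add: right_diff_distrib)
  also have "\<dots> = (1 / ?m) ^ k * (\<Prod>i<k. ?m - real i)"
    by (simp only: prod.distrib prod_constant card_lessThan)
  finally have "clique_lagrangian d k = (1 / ?m) ^ Suc k * ((\<Prod>i<k. ?m - real i) * real d) / fact (Suc k)"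
    unfolding clique_lagrangian_def cap_poly_def by (simp add: mult_ac del: fact_Suc of_nat_add)
  \<comment> \<open>The factor \<open>d\<close> is the last factor of the falling factorial, the one
    with \<open>i = k\<close>.\<close>
  also have "(\<Prod>i<k. ?m - real i) * real d = (\<Prod>i<Suc k. ?m - real i)" by simp
  also have "(1 / ?m) ^ Suc k * (\<Prod>i<Suc k. ?m - real i) / fact (Suc k) =
      (1 / ?m) ^ Suc k * real ((d + k) choose Suc k)"
    unfolding binomial_gbinomial gbinomial_prod_rev
    by (simp only: atLeast0LessThan times_divide_eq_right of_nat_fact)
  finally show ?thesis by (simp only: mult.commute)
qed

text \<open>A density within \<delta> of the family Lagrangian is by this bound at least
  \<open>clique_lagrangian\<close> minus \<delta>, as the stability lemma requires.\<close>

lemma clique_lagrangian_le_family_lagrangian: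
  assumes "0 < d"
  shows "clique_lagrangian d k \<le> family_lagrangian (blowups (complete_rgraph (Suc k) (d + k)))"
proof -
  let ?K = "complete_rgraph (Suc k) (d + k)"
  let ?\<mu> = "\<lambda>_. 1 / real (card (verts ?K))"
  have K: "rgraph (Suc k) ?K" using assms by (intro complete_rgraph_rgraph) simp
  have "hg_density ?K ?\<mu> = real (card (edges ?K)) * (1 / real (d + k)) ^ Suc k"
    by (simp add: hg_density_def complete_rgraph_def)
  also have "card (edges ?K) = (d + k) choose Suc k"
    using n_subsets[of "{..<d + k}" "Suc k"] by (simp add: complete_rgraph_def)
  finally have "clique_lagrangian d k = hg_density ?K ?\<mu>"
    by (simp only: clique_lagrangian_eq[OF assms])
  also have "\<dots> \<le> lagrangian ?K"
    using K by (intro hg_density_le_lagrangian uniform_distribution)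
  also have "\<dots> \<le> family_lagrangian (blowups ?K)"
    unfolding family_lagrangian_def
  proof (rule cSUP_upper)
    show "?K \<in> blowups ?K" unfolding blowups_def using hg_iso_id by blast
    show "bdd_above (lagrangian ` blowups ?K)"
      using lagrangian_le_1 blowups_rgraph[OF K] by (intro bdd_aboveI[of _ 1]) blast
  qed
  finally show ?thesis .
qed

section \<open>The nearby blowup of a clique\<close>

lemma blowup_complete_on:
  fixes V S :: "nat set"
  assumes "finite V" and "S \<subseteq> V" and "card S = m" and "0 < m"
  obtains H where "H \<in> blowups (complete_rgraph r m)" and "verts H = V"
    and "\<And>e. e \<subseteq> S \<Longrightarrow> card e = r \<Longrightarrow> e \<in> edges H"
proof -
  define n where "n = card V"
  have mn: "m \<le> n" using assms card_mono by (auto simp: n_def)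
  \<comment> \<open>A single cloning of the vertex 0 creates all surplus vertices. The hypergraph
    \<open>G\<close> below is its result: the \<open>r\<close>-sets meeting the enlarged part
    \<open>W\<close> at most once.\<close>
  define W where "W = insert 0 {m..<n}"
  define G where "G = Hypergraph {..<n} {e. e \<subseteq> {..<n} \<and> card e = r \<and> card (e \<inter> W) \<le> 1}"
  let ?K = "complete_rgraph r m"
  have link_G: "link G w = {I. I \<subseteq> {..<n} - W \<and> card (insert w I) = r \<and> w \<notin> I}" if w: "w \<in> W" for w
  proof (intro set_eqI iffI)
    have wn: "w < n" using w mn assms(4) by (auto simp: W_def)
    fix I
    {
      assume "I \<in> link G w"
      then have I: "w \<notin> I" "insert w I \<subseteq> {..<n}" "card (insert w I) = r" "card (insert w I \<inter> W) \<le> 1"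
        by (auto simp: link_def G_def)
      have "I \<inter> W = {}"
      proof (rule ccontr)
        assume "I \<inter> W \<noteq> {}"
        then obtain v where v: "v \<in> I" "v \<in> W" by blast
        have "finite (insert w I \<inter> W)" using I(2) finite_subset by blast
        then have "card {w, v} \<le> card (insert w I \<inter> W)" using v w by (intro card_mono) auto
        moreover have "card {w, v} = 2" using v I(1) by (cases "w = v") auto
        ultimately show False using I(4) by simp
      qed
      then show "I \<in> {I. I \<subseteq> {..<n} - W \<and> card (insert w I) = r \<and> w \<notin> I}" using I by auto
    }
    {
      assume I: "I \<in> {I. I \<subseteq> {..<n} - W \<and> card (insert w I) = r \<and> w \<notin> I}"
      then have "insert w I \<inter> W = {w}" using w by auto
      then show "I \<in> link G w" using I wn by (auto simp: link_def G_def)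
    }
  qed
  have link_K: "link ?K 0 = {I. I \<subseteq> {..<n} - W \<and> card (insert 0 I) = r \<and> 0 \<notin> I}"
  proof -
    have "{..<n} - W = {..<m} - {0}" using mn by (auto simp: W_def)
    then show ?thesis using assms(4) by (auto simp: link_def complete_rgraph_def)
  qed
  have "card (insert w I) = card (insert 0 I)" if "w \<in> W" "I \<subseteq> {..<n} - W" for w I
  proof -
    have "w \<notin> I" "0 \<notin> I" "finite I" using that finite_subset by (auto simp: W_def)
    then show ?thesis by simp
  qed
  note card_eq = this
  have link_eq: "link G w = link ?K 0" if w: "w \<in> W" for w
    unfolding link_G[OF w] link_K
  proof (rule Collect_cong)
    fix I
    have "w \<notin> I" "0 \<notin> I" if "I \<subseteq> {..<n} - W" using that w by (auto simp: W_def)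
    then show "(I \<subseteq> {..<n} - W \<and> card (insert w I) = r \<and> w \<notin> I) \<longleftrightarrow>
        (I \<subseteq> {..<n} - W \<and> card (insert 0 I) = r \<and> 0 \<notin> I)"
      using card_eq[OF w, of I] by metis
  qed
  have "clone ?K 0 W G"
    unfolding clone_def
  proof (intro conjI ballI link_eq)
    show "edges ?K \<subseteq> edges G"
    proof
      fix e assume "e \<in> edges ?K"
      then have e: "e \<subseteq> {..<m}" "card e = r" by (auto simp: complete_rgraph_def)
      then have "e \<inter> W \<subseteq> {0}" by (auto simp: W_def)
      then have "card (e \<inter> W) \<le> 1" using card_mono[of "{0}" "e \<inter> W"] by simp
      then show "e \<in> edges G" using e mn by (auto simp: G_def)
    qed
    show "e \<inter> W \<noteq> {}" if e: "e \<in> edges G - edges ?K" for e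
    proof -
      obtain i where "i \<in> e" "\<not> i < m" "i < n"
        using e by (auto simp: G_def complete_rgraph_def)
      then show ?thesis by (auto simp: W_def)
    qed
  qed (use mn assms(4) in \<open>auto simp: W_def G_def complete_rgraph_def\<close>)
  then have step: "clone_delete_step ?K G" by (rule cloning)
  have "finite S" "finite (V - S)" using assms finite_subset by auto
  then obtain f1 f2 where f1: "bij_betw f1 {..<m} S" and f2: "bij_betw f2 {m..<n} (V - S)"
    using finite_same_card_bij[of "{..<m}" S] finite_same_card_bij[of "{m..<n}" "V - S"] assms
    by (auto simp: n_def card_Diff_subset)
  \<comment> \<open>The original clique vertices are renamed to \<open>S\<close>, and the clones to
    the rest of \<open>V\<close>. Thus \<open>S\<close> has one vertex in each part, and every set
    of \<open>r\<close> of its vertices is an edge.\<close>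
  define f where "f = (\<lambda>i. if i < m then f1 i else f2 i)"
  have fS: "bij_betw f {..<m} S"
    using f1 by (subst bij_betw_cong[of _ _ f1]) (auto simp: f_def)
  moreover have "bij_betw f {m..<n} (V - S)"
    using f2 by (subst bij_betw_cong[of _ _ f2]) (auto simp: f_def)
  ultimately have "bij_betw f ({..<m} \<union> {m..<n}) (S \<union> (V - S))"
    by (rule bij_betw_combine) auto
  moreover have "{..<m} \<union> {m..<n} = {..<n}" "S \<union> (V - S) = V" using mn assms(2) by auto
  ultimately have f: "bij_betw f {..<n} V" by simp
  define H where "H = Hypergraph V ((`) f ` edges G)"
  show thesis
  proof (rule that[of H])
    have "hg_iso f G H" using f by (simp add: hg_iso_def H_def G_def)
    then show "H \<in> blowups ?K" unfolding blowups_def using step by blast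
    show "verts H = V" by (simp add: H_def)
    fix e assume e: "e \<subseteq> S" "card e = r"
    define e' where "e' = {i \<in> {..<m}. f i \<in> e}"
    have img: "f ` e' = e"
      using fS e(1) unfolding e'_def bij_betw_def by blast
    have "inj_on f e'" using fS unfolding e'_def bij_betw_def by (auto intro: inj_on_subset)
    then have "card e' = r" using img e(2) card_image by metis
    moreover have "e' \<inter> W \<subseteq> {0}" by (auto simp: W_def e'_def)
    then have "card (e' \<inter> W) \<le> 1" using card_mono[of "{0}" "e' \<inter> W"] by simp
    ultimately have "e' \<in> edges G" using mn by (auto simp: G_def e'_def)
    then show "e \<in> edges H" using img by (auto simp: H_def)
  qed
qed

text \<open>Each edge is charged to its vertices in \<open>D\<close>. The edges at \<open>v\<close>
  weigh at most \<open>x v\<close>, since a link density is at most 1.\<close>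

lemma edge_density_meeting_le:
  assumes E: "uniform (Suc k) V E" and x0: "\<And>v. v \<in> V \<Longrightarrow> 0 \<le> x v" and x1: "(\<Sum>v\<in>V. x v) = 1"
    and D: "D \<subseteq> V" "\<And>e. e \<in> E \<Longrightarrow> e \<inter> D \<noteq> {}"
  shows "edge_density E x \<le> (\<Sum>v\<in>D. x v)"
proof -
  have fin: "finite E" "finite D" "finite V"
    using uniform_finite[OF E] E D(1) finite_subset by (auto simp: uniform_def)
  have "edge_density E x \<le> (\<Sum>e\<in>E. \<Sum>v | v \<in> D \<and> v \<in> e. \<Prod>v\<in>e. x v)"
    unfolding edge_density_def
  proof (rule sum_mono)
    fix e assume e: "e \<in> E"
    have "0 < card {v. v \<in> D \<and> v \<in> e}" using D(2)[OF e] fin by (auto simp: card_gt_0_iff)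
    then have "1 \<le> real (card {v. v \<in> D \<and> v \<in> e})" by simp
    moreover have "0 \<le> (\<Prod>v\<in>e. x v)" using E e x0 by (intro prod_nonneg) (auto simp: uniform_def)
    ultimately have "1 * (\<Prod>v\<in>e. x v) \<le> real (card {v. v \<in> D \<and> v \<in> e}) * (\<Prod>v\<in>e. x v)"
      by (rule mult_right_mono)
    then show "(\<Prod>v\<in>e. x v) \<le> (\<Sum>v | v \<in> D \<and> v \<in> e. \<Prod>v\<in>e. x v)" by simp
  qed
  also have "\<dots> = (\<Sum>v\<in>D. \<Sum>e | e \<in> E \<and> v \<in> e. \<Prod>v\<in>e. x v)"
    by (rule sum.swap_restrict[symmetric]) (use fin in auto)
  also have "\<dots> = (\<Sum>v\<in>D. x v * edge_density (link_edges E v) x)"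
    using edge_density_link[OF E] by simp
  also have "\<dots> \<le> (\<Sum>v\<in>D. x v * 1)"
  proof (intro sum_mono mult_left_mono)
    fix v assume "v \<in> D"
    then show "0 \<le> x v" using D(1) x0 by auto
    have "edge_density (link_edges E v) x \<le> (\<Sum>w\<in>V - {v}. x w) ^ k"
      using edge_density_le_power[OF uniform_link[OF E]] x0 by simp
    also have "\<dots> \<le> 1 ^ k"
      unfolding x1[symmetric] using x0 fin by (intro power_mono sum_mono2 sum_nonneg) auto
    finally show "edge_density (link_edges E v) x \<le> 1" by simp
  qed
  finally show ?thesis by simp
qed

text \<open>Edges not inside \<open>S\<close> weigh at most as much as the vertices outside
  \<open>S\<close>. They count twice: as possible disagreements, and as density of \<open>F\<close>
  not realised inside \<open>S\<close>. By the Lagrangian bound for the clique on \<open>S\<close>,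
  the edges of \<open>S\<close> missing from \<open>F\<close> weigh at most \<delta> plus that
  amount.\<close>

lemma dist_common_complete_on_le:
  fixes F H :: "'a hypergraph"
  assumes d: "2 * k\<^sup>2 \<le> d" "0 < d"
    and F: "rgraph (Suc k) F" "\<mu> \<in> distributions F"
    and H: "rgraph (Suc k) H" "verts H = verts F"
    and S: "S \<subseteq> verts F" "card S = d + k" "\<And>e. e \<subseteq> S \<Longrightarrow> card e = Suc k \<Longrightarrow> e \<in> edges H"
    and p: "clique_lagrangian d k - \<delta> \<le> hg_density F \<mu>"
  shows "dist_common F H \<mu> \<le> 2 * (\<Sum>v\<in>verts F - S. \<mu> v) + \<delta>"
proof -
  let ?V = "verts F"
  define KS where "KS = {e. e \<subseteq> S \<and> card e = Suc k}"
  define KD where "KD = {e. e \<subseteq> ?V \<and> card e = Suc k \<and> \<not> e \<subseteq> S}"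
  have finV: "finite ?V" using F by (simp add: rgraph_def)
  have x0: "\<And>v. v \<in> ?V \<Longrightarrow> 0 \<le> \<mu> v" and x1: "(\<Sum>v\<in>?V. \<mu> v) = 1"
    using F by (auto simp: distributions_def)
  have uKS: "uniform (Suc k) ?V KS" and uKD: "uniform (Suc k) ?V KD"
    using finV S(1) by (auto simp: uniform_def KS_def KD_def)
  have finS: "finite S" using S finV finite_subset by auto
  have KD: "edge_density KD \<mu> \<le> (\<Sum>v\<in>?V - S. \<mu> v)"
    by (rule edge_density_meeting_le[OF uKD x0 x1]) (auto simp: KD_def)
  have "edge_density KS \<mu> \<le> clique_lagrangian d k * (\<Sum>v\<in>S. \<mu> v) ^ Suc k"
    unfolding KS_def using S x0
    by (intro edge_density_le_clique_lagrangian[OF complete_link_sparse[OF finS S(2)] d]) auto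
  also have "\<dots> \<le> clique_lagrangian d k * 1 ^ Suc k"
    unfolding x1[symmetric] using x0 finV S clique_lagrangian_pos[OF d(2), of k]
    by (intro mult_left_mono power_mono sum_mono2 sum_nonneg) auto
  finally have KS: "edge_density KS \<mu> \<le> clique_lagrangian d k" by simp
  have split_add: "edge_density (A \<union> B) \<mu> = edge_density A \<mu> + edge_density B \<mu>"
    if "A \<inter> B = {}" "finite A" "finite B" for A B
    using that by (simp add: edge_density_def sum.union_disjoint)
  have fin: "finite KS" "finite KD" using uKS uKD uniform_finite by auto
  have "edges F \<subseteq> KS \<inter> edges F \<union> KD" using F by (auto simp: rgraph_def KS_def KD_def)
  then have "hg_density F \<mu> \<le> edge_density (KS \<inter> edges F \<union> KD) \<mu>"
    unfolding hg_density_def edge_density_def[symmetric]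
    using uKS uKD x0 by (intro edge_density_mono_edges) (auto simp: uniform_def)
  also have "\<dots> = edge_density (KS \<inter> edges F) \<mu> + edge_density KD \<mu>"
    using fin by (intro split_add) (auto simp: KS_def KD_def)
  finally have 1: "hg_density F \<mu> \<le> edge_density (KS \<inter> edges F) \<mu> + edge_density KD \<mu>" .
  have "edge_density KS \<mu> = edge_density ((KS \<inter> edges F) \<union> (KS - edges F)) \<mu>"
    by (simp add: Int_Diff_Un)
  also have "\<dots> = edge_density (KS \<inter> edges F) \<mu> + edge_density (KS - edges F) \<mu>"
    using fin by (intro split_add) auto
  finally have 2: "edge_density KS \<mu> = edge_density (KS \<inter> edges F) \<mu> + edge_density (KS - edges F) \<mu>" .
  have "sym_diff (edges F) (edges H) \<subseteq> (KS - edges F) \<union> KD"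
    using F H S(3) by (auto simp: rgraph_def KS_def KD_def)
  then have "dist_common F H \<mu> \<le> edge_density ((KS - edges F) \<union> KD) \<mu>"
    unfolding dist_common_def edge_density_def[symmetric]
    using uKS uKD x0 by (intro edge_density_mono_edges) (auto simp: uniform_def)
  also have "\<dots> = edge_density (KS - edges F) \<mu> + edge_density KD \<mu>"
    using fin by (intro split_add) (auto simp: KS_def KD_def)
  finally show ?thesis using 1 2 KS KD p by linarith
qed

theorem theorem4p2:
  fixes r :: nat
  assumes "r \<ge> 2"
  shows "\<exists>M :: real. \<forall>(T :: nat hypergraph) (t :: nat).
    erdos_sos_tree T \<and> card (verts T) = t \<and> real t \<ge> M \<longrightarrow>
      weakly_weight_stable (blowups (complete_rgraph r (t + r - 3)))
        (Forb r (expansion (r - 2) T))"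
proof (intro exI allI impI)
  fix T :: "nat hypergraph" and t :: nat
  \<comment> \<open>This fixes the witness for \<open>M\<close>. It yields
    \<open>2 * (r - 1)\<^sup>2 \<le> t - 2\<close>, the largeness of \<open>d\<close> required for
    uniformity \<open>r\<close>.\<close>
  assume T: "erdos_sos_tree T \<and> card (verts T) = t \<and> real (2 * r\<^sup>2 + 2) \<le> real t"
  obtain k where r: "r = Suc (Suc k)" using assms by (intro that[of "r - 2"]) simp
  define d where "d = t - 2"
  have "2 * r\<^sup>2 + 2 \<le> t" using T by (simp only: of_nat_le_iff)
  moreover have "(Suc k)\<^sup>2 < r\<^sup>2" unfolding r by (intro power_strict_mono) auto
  ultimately have d: "2 * (Suc k)\<^sup>2 \<le> d" "0 < d" "2 \<le> t" and m: "t + r - 3 = d + Suc k"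
    unfolding d_def r by linarith+
  let ?m = "real (d + Suc k)" and ?L = "clique_lagrangian d (Suc k)"
  let ?H = "blowups (complete_rgraph r (d + Suc k))"
  have HH: "rgraph r H" if "H \<in> ?H" for H
    using blowups_rgraph[OF complete_rgraph_rgraph that] by simp
  have L: "?L \<le> family_lagrangian ?H"
    using clique_lagrangian_le_family_lagrangian[OF d(2), of "Suc k"] by (simp add: r)
  show "weakly_weight_stable (blowups (complete_rgraph r (t + r - 3))) (Forb r (expansion (r - 2) T))"
    unfolding m weakly_weight_stable_def
  proof (intro allI impI)
    fix \<epsilon> :: real assume "0 < \<epsilon>"
    \<comment> \<open>If each of the \<open>d + Suc k\<close> vertices lacks at most this much, the
      others have total weight at most \<open>\<epsilon> / 4\<close>. Doubled in the distance
      estimate, this leaves \<open>\<epsilon> / 2\<close> for the deficit in density.\<close>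
    then have "0 < \<epsilon> / (4 * ?m)" by simp
    from weighted_sparse_stability[OF d(1,2) this, where 'a = nat]
    obtain \<delta> where \<delta>: "0 < \<delta>"
      "\<forall>V E (x :: nat \<Rightarrow> real). weighted_sparse d (Suc k) V E x \<and> ?L - \<delta> \<le> edge_density E x \<longrightarrow>
        (\<exists>S\<subseteq>V. card S = d + Suc k \<and> (\<forall>v\<in>S. 1 / ?m - \<epsilon> / (4 * ?m) \<le> x v))"
      by (elim exE conjE)
    show "\<exists>\<delta>>0. \<forall>F\<in>Forb r (expansion (r - 2) T). \<forall>\<mu>\<in>distributions F.
        family_lagrangian ?H - \<delta> \<le> hg_density F \<mu> \<longrightarrow> dist_to_family ?H (F, \<mu>) \<le> \<epsilon>"
    proof (intro exI[of _ "min \<delta> (\<epsilon> / 2)"] conjI ballI impI)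
      show "0 < min \<delta> (\<epsilon> / 2)" using \<delta>(1) \<open>0 < \<epsilon>\<close> by simp
      fix F :: "nat hypergraph" and \<mu> assume F: "F \<in> Forb r (expansion (r - 2) T)" and \<mu>: "\<mu> \<in> distributions F"
        and p: "family_lagrangian ?H - min \<delta> (\<epsilon> / 2) \<le> hg_density F \<mu>"
      have rF: "rgraph r F" using F by (simp add: Forb_def)
      have finV: "finite (verts F)" using rF by (simp add: rgraph_def)
      have "link_sparse d r (verts F) (edges F)"
        using Forb_link_sparse[OF _ _ d(3) F] T by (simp add: d_def)
      then have "weighted_sparse d (Suc k) (verts F) (edges F) \<mu>"
        using \<mu> by (simp add: weighted_sparse_def distributions_def r)
      moreover have "?L - \<delta> \<le> edge_density (edges F) \<mu>"
        using p L unfolding hg_density_def edge_density_def by linarith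
      ultimately obtain S where S: "S \<subseteq> verts F" "card S = d + Suc k"
        "\<And>v. v \<in> S \<Longrightarrow> 1 / ?m - \<epsilon> / (4 * ?m) \<le> \<mu> v"
        using \<delta>(2)[rule_format, of "verts F" "edges F" \<mu>] by blast
      obtain H where H: "H \<in> ?H" "verts H = verts F" "\<And>e. e \<subseteq> S \<Longrightarrow> card e = r \<Longrightarrow> e \<in> edges H"
        using blowup_complete_on[OF finV S(1,2), of r] by auto
      have "dist_to_family ?H (F, \<mu>) \<le> dist_common F H \<mu>"
        using HH by (rule dist_to_family_le_dist_common[OF rF \<mu> _ H(1,2)])
      also have "\<dots> \<le> 2 * (\<Sum>v\<in>verts F - S. \<mu> v) + \<epsilon> / 2"
      proof (rule dist_common_complete_on_le[OF d(1,2) _ \<mu> _ H(2) S(1,2)])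
        show "?L - \<epsilon> / 2 \<le> hg_density F \<mu>" using p L by linarith
      qed (use rF HH[OF H(1)] H(3) r in auto)
      also have "(\<Sum>v\<in>verts F - S. \<mu> v) \<le> \<epsilon> / 4"
      proof -
        have "real (card S) * (1 / ?m - \<epsilon> / (4 * ?m)) \<le> (\<Sum>v\<in>S. \<mu> v)"
          using S(3) by (rule sum_bounded_below)
        moreover have "real (card S) * (1 / ?m - \<epsilon> / (4 * ?m)) = 1 - \<epsilon> / 4"
        proof -
          have "m * (1 / m - \<epsilon> / (4 * m)) = 1 - \<epsilon> / 4" if "0 < m" for m :: real
            using that by (simp add: field_simps)
          moreover have "0 < ?m" by simp
          ultimately show ?thesis unfolding S(2) by blast
        qed
        moreover have "(\<Sum>v\<in>verts F - S. \<mu> v) = 1 - (\<Sum>v\<in>S. \<mu> v)"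
          using sum.subset_diff[OF S(1) finV, of \<mu>] \<mu> by (simp add: distributions_def)
        ultimately show ?thesis by linarith
      qed
      finally show "dist_to_family ?H (F, \<mu>) \<le> \<epsilon>" by simp
    qed
  qed
qed

end
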